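(* Let $I^3_4$ be the 3-graph on 4 vertices with no edges and let $H_4$ be the 3-graph on $\{1,2,3,4,5\}$ with edge set $\{123,124,234,135\}$. Then $\pi_{\min}(I^3_4,H_4)=\frac49$.
   Context: A 3-graph is a 3-uniform hypergraph. For a finite family $\mathcal H$ of 3-graphs and an integer $n$, $\mathrm{ex}_{\min}(n;\mathcal H)$ denotes the minimal possible number of edges in an $n$-vertex 3-graph containing no member of $\mathcal H$ as an induced subgraph, and $\pi_{\min}(\mathcal H)=\lim_{n\to\infty}\mathrm{ex}_{\min}(n;\mathcal H)/\binom n3$ (this limit exists). *)

theory Defs
  imports Complex_Main
begin

record 'a hypergraph =
  verts :: "'a set"
  edges :: "'a set set"

definition three_graph :: "'a hypergraph \<Rightarrow> bool" where
  "three_graph G \<longleftrightarrow> finite (verts G) \<and> (\<forall>e\<in>edges G. e \<subseteq> verts G \<and> card e = 3)"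

definition induced :: "'a hypergraph \<Rightarrow> 'a set \<Rightarrow> 'a hypergraph" where
  "induced G W = \<lparr>verts = W, edges = {e \<in> edges G. e \<subseteq> W}\<rparr>"

definition isomorphic :: "'a hypergraph \<Rightarrow> 'b hypergraph \<Rightarrow> bool" where
  "isomorphic H G \<longleftrightarrow>
     (\<exists>f. bij_betw f (verts H) (verts G) \<and> edges G = (\<lambda>e. f ` e) ` edges H)"

definition contains_induced :: "'b hypergraph \<Rightarrow> 'a hypergraph \<Rightarrow> bool" where
  "contains_induced G H \<longleftrightarrow> (\<exists>W \<subseteq> verts G. isomorphic H (induced G W))"

definition induced_free :: "'a hypergraph set \<Rightarrow> 'b hypergraph \<Rightarrow> bool" where
  "induced_free \<H> G \<longleftrightarrow> (\<forall>H\<in>\<H>. \<not> contains_induced G H)"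

text \<open>Vertices are taken in \<^typ>\<open>nat\<close>, which loses nothing up to isomorphism. The infimum
  over the natural numbers is attained as soon as some induced-free 3-graph on \<open>n\<close> vertices
  exists; otherwise the value is meaningless.\<close>

definition ex_min :: "nat \<Rightarrow> 'a hypergraph set \<Rightarrow> nat" where
  "ex_min n \<H> = Inf {card (edges G) | G :: nat hypergraph.
     three_graph G \<and> card (verts G) = n \<and> induced_free \<H> G}"

definition density_min :: "'a hypergraph set \<Rightarrow> nat \<Rightarrow> real" where
  "density_min \<H> n = real (ex_min n \<H>) / real (n choose 3)"

text \<open>Since \<^const>\<open>lim\<close> is unspecified on divergent sequences, \<open>pi_min \<H>\<close> is meaningful
  only together with \<open>convergent (density_min \<H>)\<close>.\<close>

definition pi_min :: "'a hypergraph set \<Rightarrow> real" where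
  "pi_min \<H> = lim (density_min \<H>)"

definition I34 :: "nat hypergraph" where
  "I34 = \<lparr>verts = {1, 2, 3, 4}, edges = {}\<rparr>"

definition H4 :: "nat hypergraph" where
  "H4 = \<lparr>verts = {1, 2, 3, 4, 5}, edges = {{1, 2, 3}, {1, 2, 4}, {2, 3, 4}, {1, 3, 5}}\<rparr>"

lemma three_graph_I34: "three_graph I34"
  by (simp add: three_graph_def I34_def)

lemma three_graph_H4: "three_graph H4"
  by (simp add: three_graph_def H4_def)

text \<open>Complete 3-graphs show that the infimum in \<^const>\<open>ex_min\<close> is over a nonempty set for
  the family at hand.\<close>

lemma induced_free_complete:
  fixes V :: "'a set"
  defines "G \<equiv> \<lparr>verts = V, edges = {e. e \<subseteq> V \<and> card e = 3}\<rparr>"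
  shows "induced_free {I34, H4} G"
proof -
  have no: "\<not> contains_induced G H"
    if s: "s \<subseteq> verts H" "card s = 3" "s \<notin> edges H" and H: "three_graph H"
    for H :: "nat hypergraph" and s
  proof
    assume "contains_induced G H"
    then obtain W f where W: "W \<subseteq> V" and f: "bij_betw f (verts H) W"
      and E: "{e. e \<subseteq> V \<and> card e = 3 \<and> e \<subseteq> W} = (\<lambda>e. f ` e) ` edges H"
      by (auto simp: contains_induced_def isomorphic_def induced_def G_def)
    have inj: "inj_on f (verts H)" and im: "f ` verts H = W"
      using f by (auto simp: bij_betw_def)
    have "card (f ` s) = 3"
      using s inj by (metis card_image inj_on_subset)
    moreover have "f ` s \<subseteq> W"
      using s(1) im by blast
    ultimately have "f ` s \<in> {e. e \<subseteq> V \<and> card e = 3 \<and> e \<subseteq> W}"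
      using W by simp
    then have "f ` s \<in> (\<lambda>e. f ` e) ` edges H"
      unfolding E .
    then obtain e where e: "e \<in> edges H" "f ` s = f ` e"
      by (elim imageE)
    then have "e \<subseteq> verts H" using H by (auto simp: three_graph_def)
    then have "s = e" using e s(1) inj by (meson inj_on_image_eq_iff)
    then show False using e s(3) by simp
  qed
  have "{1, 2, 5} \<notin> edges H4"
    by (auto simp: H4_def insert_eq_iff)
  then have "\<not> contains_induced G H4"
    by (intro no[of "{1, 2, 5}"] three_graph_H4) (auto simp: H4_def)
  moreover have "\<not> contains_induced G I34"
    by (intro no[of "{1, 2, 3}"] three_graph_I34) (auto simp: I34_def)
  ultimately show ?thesis by (simp add: induced_free_def)
qed

end

(*
Regard a triple with a repeated vertex as an edge. This keeps a 3-graph free of induced I_4^3 and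
H_4, and it turns the lower bound into the exact inequality P(xyz is an edge) >= 4/9 for independent
uniform vertices x, y, z, which is proved by a flag algebra computation on six vertices.

For a four-set abcd with exactly one edge, or with exactly two edges, fix some integer functions of
the link of a vertex x on abcd. The square of the sum over x of such a function is nonnegative.
A combination of the edge density s and the mean square of the vertex degrees, minus weighted sums
of these squares, is the average over random six-tuples of a quantity that, symmetrized, is
nonnegative on every admissible 6-vertex 3-graph. By Cauchy-Schwarz for the degrees,
(9s - 4)(1 - s) >= 0 follows.

The upper bound is Turan's construction, none of whose 4-sets span exactly three edges.
*)
theory Submission
  imports Defs "HOL-Real_Asymp.Real_Asymp"
begin

section \<open>The certificate\<close>

text \<open>The link of a vertex \<open>x\<close> on a four-set \<open>abcd\<close> tells for each of the pairs
  \<open>ab\<close>, \<open>ac\<close>, \<open>ad\<close>, \<open>bc\<close>, \<open>bd\<close>, \<open>cd\<close>, in this order, whether it forms an edge with \<open>x\<close>.\<close>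

datatype link = Link bool bool bool bool bool bool

primrec swap12 :: "link \<Rightarrow> link" where
  "swap12 (Link ab ac ad bc bd cd) = Link ab bc bd ac ad cd"

primrec swap23 :: "link \<Rightarrow> link" where
  "swap23 (Link ab ac ad bc bd cd) = Link ac ab ad bc cd bd"

primrec swap34 :: "link \<Rightarrow> link" where
  "swap34 (Link ab ac ad bc bd cd) = Link ab ad ac bd bc cd"

text \<open>Complementary pairs in a link count pairs of edges that meet exactly in \<open>x\<close>, whose average is the
  mean square of the vertex degrees.\<close>

primrec match_weight :: "link \<Rightarrow> int" where
  "match_weight (Link ab ac ad bc bd cd) =
    - 12 * (of_bool (ab \<and> cd) + of_bool (ac \<and> bd) + of_bool (ad \<and> bc))"

definition edge_count :: "bool \<Rightarrow> bool \<Rightarrow> bool \<Rightarrow> bool \<Rightarrow> int" where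
  "edge_count p q r s = of_bool p + of_bool q + of_bool r + of_bool s"

definition edge_weight :: "bool \<Rightarrow> bool \<Rightarrow> bool \<Rightarrow> bool \<Rightarrow> int" where
  "edge_weight p q r s = 26 * (of_bool p + of_bool q + of_bool r + of_bool s) - 32"

text \<open>Links on a four-set whose only edge is \<open>abc\<close>, up to permutations of \<open>a\<close>, \<open>b\<close>, \<open>c\<close>. Class 0 collects
  the links on which the certificate vanishes; class 7 is the 4-cycle.\<close>

primrec class1 :: "link \<Rightarrow> nat" where
  "class1 (Link ab ac ad bc bd cd) =
    (let k = of_bool ab + of_bool ac + of_bool bc; s = of_bool ad + of_bool bd + of_bool cd in
     if k = 2 \<and> s = 2 \<and> (ab \<longleftrightarrow> cd) \<and> (ac \<longleftrightarrow> bd) \<and> (ad \<longleftrightarrow> bc) then 7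
     else [[0, 0, 2, 8], [0, 3, 5, 0], [0, 0, 6, 0], [1, 4, 0, 0]] ! k ! s)"

text \<open>Links on a four-set with edges \<open>abc\<close>, \<open>abd\<close>, up to swapping \<open>a\<close>, \<open>b\<close> and swapping \<open>c\<close>, \<open>d\<close>. The
  sign is the orientation that either swap reverses; classes without orientation are positive.\<close>

primrec class2 :: "link \<Rightarrow> int" where
  "class2 (Link ab ac ad bc bd cd) =
    (let r = of_bool ac + of_bool ad + of_bool bc + of_bool bd;
       x = if r < 2 then r else if r > 2 then r + 2 else if ac = ad then 2 else if ac = bc then 3 else 4
     in (if of_bool ac + of_bool bd < (of_bool ad + of_bool bc :: nat) then -1 else 1) *
       [[0, 0, 0, 0, 1, 2, 3], [0, 0, 0, 4, 5, 6, 7],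
        [8, 9, 10, 11, 12, 0, 0], [13, 14, 15, 16, 17, 0, 0]] ! (of_bool ab + 2 * of_bool cd) ! x)"

text \<open>The vectors below and the weights in \<open>form1\<close> and \<open>form2\<close> come from a numerical solution of
  the semidefinite program. Rounding must respect two constraints: the averages over the links in
  Turan's construction vanish, and the inequality is tight on its 6-vertex subgraphs. The last
  three entries of \<open>vec2\<close> are odd under the orientation.\<close>

definition vec1 :: "nat \<Rightarrow> int list" where
  "vec1 i = [[0, 0], [4, 0], [-1, 31], [-3, -31], [3, -21], [0, 20], [2, 2], [5, 21], [-8, 0]] ! i"

definition vec2 :: "int \<Rightarrow> int list" where
  "vec2 i =
    (let (x, y) = [([0, 0, 0], [0, 0, 0]), ([12, -12, -6], [0, 9, -2]), ([5, 3, -4], [0, 0, 0]),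
       ([0, 20, -6], [0, 0, 0]), ([4, 18, 3], [0, 0, 0]), ([6, -20, 4], [0, 10, 0]),
       ([9, -3, 4], [0, 0, 0]), ([10, 0, 0], [0, 0, 0]), ([-5, 27, 0], [0, 0, 0]),
       ([-10, 8, 0], [3, 5, 0]), ([2, 4, 0], [0, 0, 0]), ([-7, -19, 0], [0, 0, 0]),
       ([0, 16, 0], [0, 4, 2]), ([-5, -27, 0], [0, 0, 0]), ([-6, -6, 4], [0, 4, 2]),
       ([8, -22, 0], [0, 0, 0]), ([0, -12, 0], [0, 0, 0]), ([0, 0, 0], [0, 4, 0])] ! nat \<bar>i\<bar>
     in x @ map (\<lambda>v. sgn i * v) y)"

fun dot :: "int list \<Rightarrow> int list \<Rightarrow> int list \<Rightarrow> int" where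
  "dot (w # ws) (x # xs) (y # ys) = w * (x * y) + dot ws xs ys"
| "dot _ _ _ = 0"

definition form1 :: "nat \<Rightarrow> nat \<Rightarrow> int" where
  "form1 i j = dot [12555, 405] (vec1 i) (vec1 j)"

definition form2 :: "int \<Rightarrow> int \<Rightarrow> int" where
  "form2 i j = dot [3348, 620, 8370, 33480, 8370, 33480] (vec2 i) (vec2 j)"

definition Q1 :: "link \<Rightarrow> link \<Rightarrow> int" where
  "Q1 l m = form1 (class1 l) (class1 m)"

definition Q2 :: "link \<Rightarrow> link \<Rightarrow> int" where
  "Q2 l m = form2 (class2 l) (class2 m)"

text \<open>The vertices are reordered so that the spanned edges become \<open>abc\<close>, or
  \<open>abc\<close> and \<open>abd\<close>. Such a reordering is unique only up to the symmetries
  of \<open>Q1\<close> and \<open>Q2\<close>, so the choice is harmless. Other four-sets carry no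
  square.\<close>

fun quad :: "bool \<Rightarrow> bool \<Rightarrow> bool \<Rightarrow> bool \<Rightarrow> link \<Rightarrow> link \<Rightarrow> int" where
  "quad True False False False l m = Q1 l m"
| "quad False True False False l m = Q1 (swap34 l) (swap34 m)"
| "quad False False True False l m = Q1 (swap34 (swap23 l)) (swap34 (swap23 m))"
| "quad False False False True l m = Q1 (swap34 (swap23 (swap12 l))) (swap34 (swap23 (swap12 m)))"
| "quad True True False False l m = Q2 l m"
| "quad True False True False l m = Q2 (swap23 l) (swap23 m)"
| "quad True False False True l m = Q2 (swap23 (swap12 l)) (swap23 (swap12 m))"
| "quad False True True False l m = Q2 (swap23 (swap34 l)) (swap23 (swap34 m))"
| "quad False True False True l m = Q2 (swap23 (swap12 (swap34 l))) (swap23 (swap12 (swap34 m)))"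
| "quad False False True True l m =
    Q2 (swap23 (swap12 (swap34 (swap23 l)))) (swap23 (swap12 (swap34 (swap23 m))))"
| "quad _ _ _ _ l m = 0"

text \<open>The factor 16740 clears the denominators 124 and 135 that are left after rounding.\<close>

definition term_val :: "bool \<Rightarrow> bool \<Rightarrow> bool \<Rightarrow> bool \<Rightarrow> link \<Rightarrow> link \<Rightarrow> int" where
  "term_val p q r s l m =
    16740 * (edge_weight p q r s + (match_weight l + match_weight m)) - quad p q r s l m"

text \<open>In \<open>H\<^sub>4\<close> the first four vertices span three edges, and the link of the fifth vertex is a
  single pair inside the missing triple.\<close>

fun no_H4 :: "bool \<Rightarrow> bool \<Rightarrow> bool \<Rightarrow> bool \<Rightarrow> link \<Rightarrow> bool" where
  "no_H4 False True True True (Link ab ac ad bc bd cd) =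
    (ad \<or> bd \<or> cd \<or> ab \<and> ac \<or> ab \<and> bc \<or> ac \<and> bc \<or> \<not> ab \<and> \<not> ac \<and> \<not> bc)"
| "no_H4 True False True True (Link ab ac ad bc bd cd) =
    (ac \<or> bc \<or> cd \<or> ab \<and> ad \<or> ab \<and> bd \<or> ad \<and> bd \<or> \<not> ab \<and> \<not> ad \<and> \<not> bd)"
| "no_H4 True True False True (Link ab ac ad bc bd cd) =
    (ab \<or> bc \<or> bd \<or> ac \<and> ad \<or> ac \<and> cd \<or> ad \<and> cd \<or> \<not> ac \<and> \<not> ad \<and> \<not> cd)"
| "no_H4 True True True False (Link ab ac ad bc bd cd) =
    (ab \<or> ac \<or> ad \<or> bc \<and> bd \<or> bc \<and> cd \<or> bd \<and> cd \<or> \<not> bc \<and> \<not> bd \<and> \<not> cd)"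
| "no_H4 _ _ _ _ l = True"

section \<open>Verification of the certificate\<close>

lemma all_links:
  "\<forall>ab ac ad bc bd cd. f (Link ab ac ad bc bd cd) = g ab ac ad bc bd cd"
  if "\<And>ab ac ad bc bd cd. f (Link ab ac ad bc bd cd) = g ab ac ad bc bd cd"
  using that by simp

lemma all_flags: "\<forall>p q r s. f p q r s = g p q r s" if "\<And>p q r s. f p q r s = g p q r s"
  using that by simp

lemma all_classes: "\<forall>i\<in>I. f i = g i" if "\<And>i. f i = g i"
  using that by simp

lemma all_class_pairs: "\<forall>i\<in>I. \<forall>j\<in>I. f i j = g i j" if "\<And>i j. f i j = g i j"
  using that by simp

declare class1.simps [simp del] class2.simps [simp del] match_weight.simps [simp del]

text \<open>Expanding the quantifiers with \<open>all_bool_eq\<close> turns the defining equation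
  into one ground equation per argument, evaluated once here and only looked up during the case
  check.\<close>

lemmas match_weight_table =
  all_links[of match_weight, OF match_weight.simps, simplified all_bool_eq, simplified]

lemmas edge_count_table =
  all_flags[of edge_count, OF edge_count_def, simplified all_bool_eq, simplified]

lemmas edge_weight_table =
  all_flags[of edge_weight, OF edge_weight_def, simplified all_bool_eq, simplified]

lemmas class1_table = all_links[of class1, OF class1.simps, simplified Let_def all_bool_eq, simplified]

lemmas class2_table = all_links[of class2, OF class2.simps, simplified Let_def all_bool_eq, simplified]

lemmas vec1_table = all_classes[of vec1, OF vec1_def, of "{0, 1, 2, 3, 4, 5, 6, 7, 8}", simplified]

text \<open>The negative indices are exactly the negative values of \<open>class2\<close>.\<close>

lemmas vec2_table = all_classes[of vec2, OF vec2_def,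
  of "{0, 1, 2, 3, 4, 5, 6, 7, 8, 9, 10, 11, 12, 13, 14, 15, 16, 17, -1, -2, -5, -6, -9, -12, -14, -17}",
  simplified]

lemmas form1_table = all_class_pairs[of form1, OF form1_def, of "{0, 1, 2, 3, 4, 5, 6, 7, 8}",
  simplified, simplified vec1_table, simplified]

lemmas form2_table = all_class_pairs[of form2, OF form2_def,
  of "{0, 1, 2, 3, 4, 5, 6, 7, 8, 9, 10, 11, 12, 13, 14, 15, 16, 17, -1, -2, -5, -6, -9, -12, -14, -17}",
  simplified, simplified vec2_table, simplified]

text \<open>One entry for each four-subset of six vertices, with the links of the two remaining
  vertices; \<open>dfe\<close> is the triple d, e, f. With addition for \<open>c\<close> this is the
  symmetrized certificate, with a conditional it is the conjunction of all admissibility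
  tests.\<close>

definition fold15 where
  "fold15 c g abc abd abe abf acd ace acf ade adf aef bcd bce bcf bde bdf bef cde cdf cef dfe =
    c (g cde cdf cef dfe (Link acd ace acf ade adf aef) (Link bcd bce bcf bde bdf bef))
   (c (g bde bdf bef dfe (Link abd abe abf ade adf aef) (Link bcd bce bcf cde cdf cef))
   (c (g bce bcf bef cef (Link abc abe abf ace acf aef) (Link bcd bde bdf cde cdf dfe))
   (c (g bcd bcf bdf cdf (Link abc abd abf acd acf adf) (Link bce bde bef cde cef dfe))
   (c (g bcd bce bde cde (Link abc abd abe acd ace ade) (Link bcf bdf bef cdf cef dfe))
   (c (g ade adf aef dfe (Link abd abe abf bde bdf bef) (Link acd ace acf cde cdf cef))
   (c (g ace acf aef cef (Link abc abe abf bce bcf bef) (Link acd ade adf cde cdf dfe))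
   (c (g acd acf adf cdf (Link abc abd abf bcd bcf bdf) (Link ace ade aef cde cef dfe))
   (c (g acd ace ade cde (Link abc abd abe bcd bce bde) (Link acf adf aef cdf cef dfe))
   (c (g abe abf aef bef (Link abc ace acf bce bcf cef) (Link abd ade adf bde bdf dfe))
   (c (g abd abf adf bdf (Link abc acd acf bcd bcf cdf) (Link abe ade aef bde bef dfe))
   (c (g abd abe ade bde (Link abc acd ace bcd bce cde) (Link abf adf aef bdf bef dfe))
   (c (g abc abf acf bcf (Link abd acd adf bcd bdf cdf) (Link abe ace aef bce bef cef))
   (c (g abc abe ace bce (Link abd acd ade bcd bde cde) (Link abf acf aef bcf bef cef))
   (g abc abd acd bcd (Link abe ace ade bce bde cde) (Link abf acf adf bcf bdf cdf)))))))))))))))"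

text \<open>Nested conditionals, unlike conjunctions, let the simplifier abandon a candidate at the first
  violated condition.\<close>

definition admissible :: "int \<Rightarrow> bool \<Rightarrow> bool \<Rightarrow> bool \<Rightarrow> bool \<Rightarrow> link \<Rightarrow> link \<Rightarrow> bool" where
  "admissible k p q r s l m =
    (if k \<le> edge_count p q r s then if no_H4 p q r s l then no_H4 p q r s m else False else False)"

text \<open>Each four-subset of five vertices leaves a single vertex, whose link is therefore passed
  twice.\<close>

fun admissible5 :: "int \<Rightarrow> bool \<Rightarrow> bool \<Rightarrow> bool \<Rightarrow> bool \<Rightarrow> link \<Rightarrow> bool" where
  "admissible5 k abc abd acd bcd (Link abe ace ade bce bde cde) =
   (if admissible k abc abd acd bcd (Link abe ace ade bce bde cde) (Link abe ace ade bce bde cde) then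
    if admissible k abc abe ace bce (Link abd acd ade bcd bde cde) (Link abd acd ade bcd bde cde) then
    if admissible k abd abe ade bde (Link abc acd ace bcd bce cde) (Link abc acd ace bcd bce cde) then
    if admissible k acd ace ade cde (Link abc abd abe bcd bce bde) (Link abc abd abe bcd bce bde) then
    admissible k bcd bce bde cde (Link abc abd abe acd ace ade) (Link abc abd abe acd ace ade)
    else False else False else False else False)"

datatype flags = Flags bool bool bool bool

fun check6 :: "int \<Rightarrow> bool \<Rightarrow> bool \<Rightarrow> bool \<Rightarrow> bool \<Rightarrow> link \<Rightarrow> link \<Rightarrow> flags \<Rightarrow> bool" where
  "check6 k abc abd acd bcd (Link abe ace ade bce bde cde) (Link abf acf adf bcf bdf cdf)
     (Flags aef bef cef dfe) =
    (if fold15 (\<lambda>x y. if x then y else False) (admissible k)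
       abc abd abe abf acd ace acf ade adf aef bcd bce bcf bde bdf bef cde cdf cef dfe
     then fold15 (+) quad
         abc abd abe abf acd ace acf ade adf aef bcd bce bcf bde bdf bef cde cdf cef dfe \<le>
       16740 * fold15 (+) (\<lambda>p q r s l m. edge_weight p q r s + (match_weight l + match_weight m))
         abc abd abe abf acd ace acf ade adf aef bcd bce bcf bde bdf bef cde cdf cef dfe
     else True)"

fun check5 :: "int \<Rightarrow> bool \<Rightarrow> bool \<Rightarrow> bool \<Rightarrow> bool \<Rightarrow> link \<Rightarrow> link \<Rightarrow> bool" where
  "check5 k p q r s l (Link a b c d e f) =
    (if admissible5 k p q r s (Link a b c d e f) then \<forall>n. check6 k p q r s l (Link a b c d e f) n
     else True)"

text \<open>The 3-graph on \<open>abcdef\<close> is enumerated in stages: the link of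
  \<open>e\<close>, the link of \<open>f\<close>, then the four triples through both. Inadmissible
  links are discarded before the next stage.\<close>

fun check4 :: "int \<Rightarrow> bool \<Rightarrow> bool \<Rightarrow> bool \<Rightarrow> bool \<Rightarrow> link \<Rightarrow> bool" where
  "check4 k p q r s (Link a b c d e f) =
    (if admissible5 k p q r s (Link a b c d e f) then \<forall>m. check5 k p q r s (Link a b c d e f) m
     else True)"

lemma all_flags_eq: "(\<forall>n. R n) \<longleftrightarrow> (\<forall>a b c d. R (Flags a b c d))"
  by (metis flags.exhaust)

lemma all_link_eq: "(\<forall>n. R n) \<longleftrightarrow> (\<forall>a b c d e f. R (Link a b c d e f))"
  by (metis link.exhaust)

lemmas check_simps =
  all_flags_eq[unfolded all_bool_eq] all_link_eq[unfolded all_bool_eq] fold15_def admissible_def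
  edge_count_table edge_weight_table match_weight_table Q1_def Q2_def form1_table form2_table
  class1_table class2_table check4.simps check5.simps check6.simps admissible5.simps no_H4.simps
  quad.simps swap12.simps swap23.simps swap34.simps if_True if_False simp_thms arith_simps rel_simps
  arith_special order.refl

section \<open>Symmetries of the certificate\<close>

lemma class_swap:
  "class1 (swap12 l) = class1 l" "class1 (swap23 l) = class1 l"
proof -
  obtain ab ac ad bc bd cd where l: "l = Link ab ac ad bc bd cd"
    by (cases l)
  show "class1 (swap12 l) = class1 l" "class1 (swap23 l) = class1 l"
    unfolding l
    by (cases ab; cases ac; cases ad; cases bc; cases bd; cases cd;
        simp only: swap12.simps swap23.simps class1_table)+
qed

definition flip :: "int list \<Rightarrow> int list" where
  "flip x = take 3 x @ map uminus (drop 3 x)"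

text \<open>Either swap reverses the orientation, which negates the three odd coordinates.\<close>

lemma vec2_swap:
  "vec2 (class2 (swap12 l)) = flip (vec2 (class2 l))"
  "vec2 (class2 (swap34 l)) = flip (vec2 (class2 l))"
  and length_vec2: "length (vec2 (class2 l)) = 6"
  and length_vec1: "length (vec1 (class1 l)) = 2"
proof -
  obtain ab ac ad bc bd cd where l: "l = Link ab ac ad bc bd cd"
    by (cases l)
  show "vec2 (class2 (swap12 l)) = flip (vec2 (class2 l))"
    "vec2 (class2 (swap34 l)) = flip (vec2 (class2 l))"
    "length (vec2 (class2 l)) = 6" "length (vec1 (class1 l)) = 2"
    unfolding l
    by (cases ab; cases ac; cases ad; cases bc; cases bd; cases cd;
        simp add: class1_table class2_table vec1_table vec2_table flip_def)+
qed

lemma dot_Cons: "dot ws (x # xs) (y # ys) = (case ws of [] \<Rightarrow> 0 | w # ws \<Rightarrow> w * (x * y) + dot ws xs ys)"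
  by (simp split: list.split)

text \<open>The form is diagonal, so the two signs meet in the same product and cancel.\<close>

lemma dot_flip:
  assumes "length x = 6" "length y = 6"
  shows "dot ws (flip x) (flip y) = dot ws x y"
  using assms by (auto simp: numeral_eq_Suc length_Suc_conv flip_def dot_Cons split: list.split)

lemma Q1_swap: "Q1 (swap12 l) (swap12 m) = Q1 l m" "Q1 (swap23 l) (swap23 m) = Q1 l m"
  by (simp_all add: Q1_def class_swap)

lemma Q2_swap: "Q2 (swap12 l) (swap12 m) = Q2 l m" "Q2 (swap34 l) (swap34 m) = Q2 l m"
  by (simp_all add: Q2_def form2_def vec2_swap dot_flip length_vec2)

lemma dot_commute: "dot w x y = dot w y x"
  by (induction w x y rule: dot.induct) (auto simp: mult.commute)

lemma Q_commute: "Q1 l m = Q1 m l" "Q2 l m = Q2 m l"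
  by (simp_all add: Q1_def Q2_def form1_def form2_def dot_commute)

lemma quad_commute: "quad p q r s l m = quad p q r s m l"
  by (cases p; cases q; cases r; cases s) (simp_all add: Q_commute)

text \<open>Relations between adjacent transpositions in the symmetric group on four points.\<close>

lemma swap_swap:
  "swap12 (swap12 l) = l" "swap23 (swap23 l) = l" "swap34 (swap34 l) = l"
  "swap34 (swap12 l) = swap12 (swap34 l)"
  "swap23 (swap12 (swap23 l)) = swap12 (swap23 (swap12 l))"
  "swap34 (swap23 (swap34 l)) = swap23 (swap34 (swap23 l))"
  "swap34 (swap23 (swap12 (swap34 l))) = swap23 (swap34 (swap23 (swap12 l)))"
  by (cases l; simp)+

text \<open>A swap may turn the reordering chosen in \<open>quad\<close> into another one of the
  same coset. The two differ by a final \<open>swap34\<close>, which \<open>Q2\<close>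
  ignores.\<close>

lemma Q2_coset:
  "Q2 (swap23 (swap34 (swap23 l))) (swap23 (swap34 (swap23 m))) = Q2 (swap23 (swap34 l)) (swap23 (swap34 m))"
  "Q2 (swap23 (swap12 (swap34 (swap23 (swap12 l))))) (swap23 (swap12 (swap34 (swap23 (swap12 m))))) =
    Q2 (swap23 (swap12 (swap34 (swap23 l)))) (swap23 (swap12 (swap34 (swap23 m))))"
proof -
  have "swap23 (swap34 (swap23 k)) = swap34 (swap23 (swap34 k))"
    "swap23 (swap12 (swap34 (swap23 (swap12 k)))) = swap34 (swap23 (swap12 (swap34 (swap23 k))))" for k
    by (cases k; simp)+
  then show
    "Q2 (swap23 (swap34 (swap23 l))) (swap23 (swap34 (swap23 m))) = Q2 (swap23 (swap34 l)) (swap23 (swap34 m))"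
    "Q2 (swap23 (swap12 (swap34 (swap23 (swap12 l))))) (swap23 (swap12 (swap34 (swap23 (swap12 m))))) =
      Q2 (swap23 (swap12 (swap34 (swap23 l)))) (swap23 (swap12 (swap34 (swap23 m))))"
    by (simp_all only: Q2_swap)
qed

lemma quad_swap:
  "quad p q s r (swap12 l) (swap12 m) = quad p q r s l m"
  "quad p r q s (swap23 l) (swap23 m) = quad p q r s l m"
  "quad q p r s (swap34 l) (swap34 m) = quad p q r s l m"
  by (cases p; cases q; cases r; cases s; simp add: Q1_swap Q2_swap Q2_coset swap_swap)+

lemma term_val_swap:
  "term_val p q s r (swap12 l) (swap12 m) = term_val p q r s l m"
  "term_val p r q s (swap23 l) (swap23 m) = term_val p q r s l m"
  "term_val q p r s (swap34 l) (swap34 m) = term_val p q r s l m"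
  "term_val p q r s m l = term_val p q r s l m"
  unfolding term_val_def quad_swap quad_commute[of p q r s m l]
  by (cases l; cases m; simp add: edge_weight_def match_weight.simps conj_commute add.commute add.left_commute)+

section \<open>Positivity on six vertices\<close>

definition link :: "('a \<Rightarrow> 'a \<Rightarrow> 'a \<Rightarrow> bool) \<Rightarrow> 'a \<Rightarrow> 'a \<Rightarrow> 'a \<Rightarrow> 'a \<Rightarrow> 'a \<Rightarrow> link" where
  "link E a b c d x = Link (E a b x) (E a c x) (E a d x) (E b c x) (E b d x) (E c d x)"

text \<open>The axioms hold for all vertices, distinct or not, so that averages can run over
  independent vertices. In \<open>no_H4_copy\<close> the vertices 1, ..., 5 of \<open>H4\<close> are
  a, b, c, d, x, and the conclusion denies its sixth non-edge.\<close>

locale triple_system =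
  fixes E :: "'a \<Rightarrow> 'a \<Rightarrow> 'a \<Rightarrow> bool"
  assumes sym12: "E a b c \<longleftrightarrow> E b a c"
    and sym23: "E a b c \<longleftrightarrow> E a c b"
    and no_I34: "E a b c \<or> E a b d \<or> E a c d \<or> E b c d"
    and no_H4_copy: "\<lbrakk>E a b c; E a b d; E b c d; E a c x; \<not> E a c d; \<not> E a b x; \<not> E a d x;
      \<not> E b c x; \<not> E b d x\<rbrakk> \<Longrightarrow> E c d x"
begin

definition cnt :: "'a \<Rightarrow> 'a \<Rightarrow> 'a \<Rightarrow> 'a \<Rightarrow> int" where
  "cnt a b c d = edge_count (E a b c) (E a b d) (E a c d) (E b c d)"

definition val :: "'a \<Rightarrow> 'a \<Rightarrow> 'a \<Rightarrow> 'a \<Rightarrow> 'a \<Rightarrow> 'a \<Rightarrow> int" where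
  "val a b c d e f = term_val (E a b c) (E a b d) (E a c d) (E b c d) (link E a b c d e) (link E a b c d f)"

lemma cnt_swap: "cnt b a c d = cnt a b c d" "cnt a c b d = cnt a b c d" "cnt a b d c = cnt a b c d"
  by (simp_all add: cnt_def edge_count_def sym12[of b a] sym23[of a c b] sym23[of b d c] sym23[of a d c]
      sym12[of c b])

lemma link_swap:
  "link E b a c d x = swap12 (link E a b c d x)"
  "link E a c b d x = swap23 (link E a b c d x)"
  "link E a b d c x = swap34 (link E a b c d x)"
  by (simp_all add: link_def sym12[of b a] sym12[of c b] sym12[of d c])

lemma val_swap:
  "val b a c d e f = val a b c d e f" "val a c b d e f = val a b c d e f"
  "val a b d c e f = val a b c d e f" "val a b c d f e = val a b c d e f"
proof -
  show "val b a c d e f = val a b c d e f"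
    unfolding val_def link_swap(1)[of b a c d e] link_swap(1)[of b a c d f] sym12[of b a]
    by (rule term_val_swap)
  show "val a c b d e f = val a b c d e f"
    unfolding val_def link_swap(2)[of a c b d e] link_swap(2)[of a c b d f] sym23[of a c b] sym12[of c b]
    by (rule term_val_swap)
  show "val a b d c e f = val a b c d e f"
    unfolding val_def link_swap(3)[of a b d c e] link_swap(3)[of a b d c f] sym23[of a d c] sym23[of b d c]
    by (rule term_val_swap)
  show "val a b c d f e = val a b c d e f"
    unfolding val_def by (rule term_val_swap)
qed

definition total :: "'a \<Rightarrow> 'a \<Rightarrow> 'a \<Rightarrow> 'a \<Rightarrow> 'a \<Rightarrow> 'a \<Rightarrow> int" where
  "total a b c d e f =
    val c d e f a b + val b d e f a c + val b c e f a d + val b c d f a e + val b c d e a f +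
    val a d e f b c + val a c e f b d + val a c d f b e + val a c d e b f +
    val a b e f c d + val a b d f c e + val a b d e c f +
    val a b c f d e + val a b c e d f + val a b c d e f"

definition all_ge :: "int \<Rightarrow> 'a \<Rightarrow> 'a \<Rightarrow> 'a \<Rightarrow> 'a \<Rightarrow> 'a \<Rightarrow> 'a \<Rightarrow> bool" where
  "all_ge k a b c d e f \<longleftrightarrow>
    k \<le> cnt c d e f \<and> k \<le> cnt b d e f \<and> k \<le> cnt b c e f \<and> k \<le> cnt b c d f \<and> k \<le> cnt b c d e \<and>
    k \<le> cnt a d e f \<and> k \<le> cnt a c e f \<and> k \<le> cnt a c d f \<and> k \<le> cnt a c d e \<and>
    k \<le> cnt a b e f \<and> k \<le> cnt a b d f \<and> k \<le> cnt a b d e \<and>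
    k \<le> cnt a b c f \<and> k \<le> cnt a b c e \<and> k \<le> cnt a b c d"

text \<open>Adjacent transpositions generate all permutations. Used as ordered rewrite rules, these
  equations sort the arguments.\<close>

lemma total_swap:
  "total b a c d e f = total a b c d e f" "total a c b d e f = total a b c d e f"
  "total a b d c e f = total a b c d e f" "total a b c e d f = total a b c d e f"
  "total a b c d f e = total a b c d e f"
  by (simp_all only: total_def val_swap)

lemma all_ge_swap:
  "all_ge k b a c d e f = all_ge k a b c d e f" "all_ge k a c b d e f = all_ge k a b c d e f"
  "all_ge k a b d c e f = all_ge k a b c d e f" "all_ge k a b c e d f = all_ge k a b c d e f"
  "all_ge k a b c d f e = all_ge k a b c d e f"
  unfolding all_ge_def
  by (simp_all only: cnt_swap) (rule iffI; elim conjE; intro conjI; assumption)+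

lemma term_val_eq:
  "term_val = (\<lambda>p q r s l m. 16740 * (edge_weight p q r s + (match_weight l + match_weight m)) - quad p q r s l m)"
  by (intro ext) (rule term_val_def)

text \<open>Connects \<open>total\<close> with \<open>check6\<close>, where the two parts of the
  certificate are summed separately and the factor 16740 is applied once.\<close>

lemma fold15_linear:
  fixes g h :: "bool \<Rightarrow> bool \<Rightarrow> bool \<Rightarrow> bool \<Rightarrow> link \<Rightarrow> link \<Rightarrow> int"
  shows "fold15 (+) (\<lambda>p q r s l m. c * g p q r s l m - h p q r s l m)
      abc abd abe abf acd ace acf ade adf aef bcd bce bcf bde bdf bef cde cdf cef dfe =
    c * fold15 (+) g abc abd abe abf acd ace acf ade adf aef bcd bce bcf bde bdf bef cde cdf cef dfe
    - fold15 (+) h abc abd abe abf acd ace acf ade adf aef bcd bce bcf bde bdf bef cde cdf cef dfe"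
  by (simp add: fold15_def algebra_simps)

lemma total_fold15:
  "total a b c d e f = fold15 (+) term_val (E a b c) (E a b d) (E a b e) (E a b f) (E a c d) (E a c e)
    (E a c f) (E a d e) (E a d f) (E a e f) (E b c d) (E b c e) (E b c f) (E b d e) (E b d f) (E b e f)
    (E c d e) (E c d f) (E c e f) (E d e f)"
  by (simp only: total_def val_def fold15_def link_def sym12 sym23 add.assoc)

text \<open>The link of \<open>x\<close> must not be a single pair inside \<open>acd\<close>. The
  three instances of \<open>no_H4_copy\<close> exclude the pairs \<open>ac\<close>,
  \<open>cd\<close> and \<open>ad\<close>.\<close>

lemma no_H4_if_missing:
  assumes "E a b c" "E a b d" "E b c d" "\<not> E a c d"
  shows "E a b x \<or> E b c x \<or> E b d x \<or> E a c x \<and> E a d x \<or> E a c x \<and> E c d x \<or> E a d x \<and> E c d x \<or>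
    \<not> E a c x \<and> \<not> E a d x \<and> \<not> E c d x"
proof -
  have "E c b d" "E c b a" "E b d a" "\<not> E c d a" "E a b d" "E a b c" "E b d c" "\<not> E a d c"
    using assms sym12 sym23 by blast+
  moreover have "E c d x \<longleftrightarrow> E d c x" "E a c x \<longleftrightarrow> E c a x" "E b c x \<longleftrightarrow> E c b x" "E a b x \<longleftrightarrow> E b a x"
    "E a d x \<longleftrightarrow> E d a x" "E b d x \<longleftrightarrow> E d b x"
    by (rule sym12)+
  ultimately show ?thesis
    using assms no_H4_copy[of a b c d x] no_H4_copy[of c b d a x] no_H4_copy[of a b d c x] by argo
qed

lemma no_H4_link: "no_H4 (E a b c) (E a b d) (E a c d) (E b c d) (link E a b c d x)"
proof -
  have sym: "E c b x \<longleftrightarrow> E b c x" "E d b x \<longleftrightarrow> E b d x" "E d c x \<longleftrightarrow> E c d x" "E b a x \<longleftrightarrow> E a b x"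
    "E b a c \<longleftrightarrow> E a b c" "E b a d \<longleftrightarrow> E a b d" "E a c b \<longleftrightarrow> E a b c" "E c b d \<longleftrightarrow> E b c d"
    "E a d b \<longleftrightarrow> E a b d" "E a d c \<longleftrightarrow> E a c d" "E d b c \<longleftrightarrow> E b c d"
    using sym12 sym23 by blast+
  show ?thesis
    using no_H4_if_missing[of a b c d x] no_H4_if_missing[of b a c d x, unfolded sym]
      no_H4_if_missing[of a c b d x, unfolded sym] no_H4_if_missing[of a d b c x, unfolded sym]
    unfolding link_def
    by (cases "E a b c"; cases "E a b d"; cases "E a c d"; cases "E b c d"; simp only: no_H4.simps simp_thms)
qed

lemma cnt_ge_1: "1 \<le> cnt a b c d"
  using no_I34[of a b c d] by (auto simp: cnt_def edge_count_def)

lemma admissible_link: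
  "k \<le> cnt a b c d \<Longrightarrow> admissible k (E a b c) (E a b d) (E a c d) (E b c d) (link E a b c d x) (link E a b c d y)"
  using no_H4_link[of a b c d] by (simp add: admissible_def cnt_def)

lemma admissible5_link:
  assumes "k \<le> cnt a b c d" "k \<le> cnt a b c e" "k \<le> cnt a b d e" "k \<le> cnt a c d e" "k \<le> cnt b c d e"
  shows "admissible5 k (E a b c) (E a b d) (E a c d) (E b c d) (link E a b c d e)"
proof -
  have
    "admissible k (E a b c) (E a b d) (E a c d) (E b c d) (link E a b c d e) (link E a b c d e)"
    "admissible k (E a b c) (E a b e) (E a c e) (E b c e) (link E a b c e d) (link E a b c e d)"
    "admissible k (E a b d) (E a b e) (E a d e) (E b d e) (link E a b d e c) (link E a b d e c)"
    "admissible k (E a c d) (E a c e) (E a d e) (E c d e) (link E a c d e b) (link E a c d e b)"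
    "admissible k (E b c d) (E b c e) (E b d e) (E c d e) (link E b c d e a) (link E b c d e a)"
    using assms by (auto intro: admissible_link)
  then show ?thesis
    by (simp only: link_def sym12 sym23 admissible5.simps if_True)
qed

lemma total_nonneg_if_check:
  assumes check: "\<forall>l. check4 k (E a b c) (E a b d) (E a c d) (E b c d) l" and ge: "all_ge k a b c d e f"
  shows "0 \<le> total a b c d e f"
proof -
  let ?fold = "\<lambda>c' g. fold15 c' g (E a b c) (E a b d) (E a b e) (E a b f) (E a c d) (E a c e)
    (E a c f) (E a d e) (E a d f) (E a e f) (E b c d) (E b c e) (E b c f) (E b d e) (E b d f) (E b e f)
    (E c d e) (E c d f) (E c e f) (E d e f)"
  have "admissible5 k (E a b c) (E a b d) (E a c d) (E b c d) (link E a b c d e)"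
    using ge by (intro admissible5_link) (auto simp: all_ge_def)
  moreover have "admissible5 k (E a b c) (E a b d) (E a c d) (E b c d) (link E a b c d f)"
    using ge by (intro admissible5_link) (auto simp: all_ge_def)
  ultimately have "\<forall>m. check5 k (E a b c) (E a b d) (E a c d) (E b c d) (link E a b c d e) m"
    and "admissible5 k (E a b c) (E a b d) (E a c d) (E b c d) (link E a b c d f)"
    using check[rule_format, of "link E a b c d e"] by (simp_all only: link_def check4.simps if_True simp_thms)
  then have "\<forall>n. check6 k (E a b c) (E a b d) (E a c d) (E b c d) (link E a b c d e) (link E a b c d f) n"
    by (metis link_def check5.simps)
  then have check6: "check6 k (E a b c) (E a b d) (E a c d) (E b c d) (link E a b c d e) (link E a b c d f)
      (Flags (E a e f) (E b e f) (E c e f) (E d e f))"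
    by blast
  have
    "admissible k (E c d e) (E c d f) (E c e f) (E d e f) (link E c d e f a) (link E c d e f b)"
    "admissible k (E b d e) (E b d f) (E b e f) (E d e f) (link E b d e f a) (link E b d e f c)"
    "admissible k (E b c e) (E b c f) (E b e f) (E c e f) (link E b c e f a) (link E b c e f d)"
    "admissible k (E b c d) (E b c f) (E b d f) (E c d f) (link E b c d f a) (link E b c d f e)"
    "admissible k (E b c d) (E b c e) (E b d e) (E c d e) (link E b c d e a) (link E b c d e f)"
    "admissible k (E a d e) (E a d f) (E a e f) (E d e f) (link E a d e f b) (link E a d e f c)"
    "admissible k (E a c e) (E a c f) (E a e f) (E c e f) (link E a c e f b) (link E a c e f d)"
    "admissible k (E a c d) (E a c f) (E a d f) (E c d f) (link E a c d f b) (link E a c d f e)"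
    "admissible k (E a c d) (E a c e) (E a d e) (E c d e) (link E a c d e b) (link E a c d e f)"
    "admissible k (E a b e) (E a b f) (E a e f) (E b e f) (link E a b e f c) (link E a b e f d)"
    "admissible k (E a b d) (E a b f) (E a d f) (E b d f) (link E a b d f c) (link E a b d f e)"
    "admissible k (E a b d) (E a b e) (E a d e) (E b d e) (link E a b d e c) (link E a b d e f)"
    "admissible k (E a b c) (E a b f) (E a c f) (E b c f) (link E a b c f d) (link E a b c f e)"
    "admissible k (E a b c) (E a b e) (E a c e) (E b c e) (link E a b c e d) (link E a b c e f)"
    "admissible k (E a b c) (E a b d) (E a c d) (E b c d) (link E a b c d e) (link E a b c d f)"
    using ge by (auto simp: all_ge_def intro!: admissible_link)
  then have "?fold (\<lambda>x y. if x then y else False) (admissible k)"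
    by (simp only: fold15_def link_def sym12 sym23 if_True)
  then have "?fold (+) quad \<le>
      16740 * ?fold (+) (\<lambda>p q r s l m. edge_weight p q r s + (match_weight l + match_weight m))"
    using check6 by (simp only: link_def check6.simps if_True)
  then show ?thesis
    unfolding total_fold15 term_val_eq fold15_linear by simp
qed

text \<open>With \<open>k\<close> the least number of edges in a four-set, that four-set may be moved to the front.\<close>

lemma total_nonneg_step:
  assumes eq: "\<And>a b c d e f. \<lbrakk>all_ge k a b c d e f; cnt a b c d = k\<rbrakk> \<Longrightarrow> 0 \<le> total a b c d e f"
    and gt: "\<And>a b c d e f. all_ge (k + 1) a b c d e f \<Longrightarrow> 0 \<le> total a b c d e f"
    and ge: "all_ge k a b c d e f"
  shows "0 \<le> total a b c d e f"
proof (rule ccontr)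
  assume neg: "\<not> 0 \<le> total a b c d e f"
  have inc: "k + 1 \<le> x" if "k \<le> x" "x \<noteq> k" for x
    using that by simp
  have
    "cnt c d e f \<noteq> k" "cnt b d e f \<noteq> k" "cnt b c e f \<noteq> k" "cnt b c d f \<noteq> k" "cnt b c d e \<noteq> k"
    "cnt a d e f \<noteq> k" "cnt a c e f \<noteq> k" "cnt a c d f \<noteq> k" "cnt a c d e \<noteq> k" "cnt a b e f \<noteq> k"
    "cnt a b d f \<noteq> k" "cnt a b d e \<noteq> k" "cnt a b c f \<noteq> k" "cnt a b c e \<noteq> k" "cnt a b c d \<noteq> k"
    using neg ge eq[of c d e f a b] eq[of b d e f a c] eq[of b c e f a d] eq[of b c d f a e]
      eq[of b c d e a f] eq[of a d e f b c] eq[of a c e f b d] eq[of a c d f b e] eq[of a c d e b f]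
      eq[of a b e f c d] eq[of a b d f c e] eq[of a b d e c f] eq[of a b c f d e] eq[of a b c e d f]
      eq[of a b c d e f]
    by (simp_all only: total_swap all_ge_swap True_implies_equals) blast+
  then have "all_ge (k + 1) a b c d e f"
    using ge unfolding all_ge_def by (elim conjE) (intro conjI inc; assumption)
  then show False
    using gt neg by blast
qed

end

section \<open>Evaluation of the certificate, by the least number of edges in a four-set\<close>

lemma check_1: "\<forall>l. check4 1 True False False False l"
  \<comment> \<open>With \<open>if_weak_cong\<close> the branches stay untouched until the condition
    is decided, so discarded candidates are never expanded.\<close>
  by (simp only: check_simps cong: if_weak_cong)
lemma check_2: "\<forall>l. check4 2 True True False False l"
  by (simp only: check_simps cong: if_weak_cong)
lemma check_3: "\<forall>l. check4 3 True True True False l"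
  by (simp only: check_simps cong: if_weak_cong)
lemma check_4: "\<forall>l. check4 4 True True True True l"
  by (simp only: check_simps cong: if_weak_cong)

context triple_system
begin

text \<open>\<open>check_1\<close> covers only the edge \<open>abc\<close>; relabelling, under which
  \<open>total\<close> and \<open>all_ge\<close> are invariant, brings the other three positions
  there. The lemmas for two and three edges proceed alike.\<close>

lemma total_nonneg_1:
  assumes "all_ge 1 a b c d e f" "cnt a b c d = 1"
  shows "0 \<le> total a b c d e f"
proof -
  have base: "0 \<le> total a b c d e f"
    if "E a b c" "\<not> E a b d" "\<not> E a c d" "\<not> E b c d" "all_ge 1 a b c d e f" for a b c d
    using that check_1 by (intro total_nonneg_if_check[of 1]) simp_all
  show ?thesis
    using assms base[of a b c d]
      base[of a b d c, simplified total_swap all_ge_swap sym12 sym23]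
      base[of a c d b, simplified total_swap all_ge_swap sym12 sym23]
      base[of b c d a, simplified total_swap all_ge_swap sym12 sym23]
    by (cases "E a b c"; cases "E a b d"; cases "E a c d"; cases "E b c d"; simp add: cnt_def edge_count_def)
qed

lemma total_nonneg_2:
  assumes "all_ge 2 a b c d e f" "cnt a b c d = 2"
  shows "0 \<le> total a b c d e f"
proof -
  have base: "0 \<le> total a b c d e f"
    if "E a b c" "E a b d" "\<not> E a c d" "\<not> E b c d" "all_ge 2 a b c d e f" for a b c d
    using that check_2 by (intro total_nonneg_if_check[of 2]) simp_all
  show ?thesis
    using assms base[of a b c d]
      base[of a c b d, simplified total_swap all_ge_swap sym12 sym23]
      base[of b c a d, simplified total_swap all_ge_swap sym12 sym23]
      base[of a d b c, simplified total_swap all_ge_swap sym12 sym23]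
      base[of b d a c, simplified total_swap all_ge_swap sym12 sym23]
      base[of c d a b, simplified total_swap all_ge_swap sym12 sym23]
    by (cases "E a b c"; cases "E a b d"; cases "E a c d"; cases "E b c d"; simp add: cnt_def edge_count_def)
qed

lemma total_nonneg_3:
  assumes "all_ge 3 a b c d e f" "cnt a b c d = 3"
  shows "0 \<le> total a b c d e f"
proof -
  have base: "0 \<le> total a b c d e f"
    if "E a b c" "E a b d" "E a c d" "\<not> E b c d" "all_ge 3 a b c d e f" for a b c d
    using that check_3 by (intro total_nonneg_if_check[of 3]) simp_all
  show ?thesis
    using assms base[of a b c d]
      base[of b a c d, simplified total_swap all_ge_swap sym12 sym23]
      base[of c a b d, simplified total_swap all_ge_swap sym12 sym23]
      base[of d a b c, simplified total_swap all_ge_swap sym12 sym23]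
    by (cases "E a b c"; cases "E a b d"; cases "E a c d"; cases "E b c d"; simp add: cnt_def edge_count_def)
qed

lemma total_nonneg_4:
  assumes "all_ge 4 a b c d e f"
  shows "0 \<le> total a b c d e f"
proof -
  have "4 \<le> cnt a b c d"
    using assms by (simp add: all_ge_def)
  then have "E a b c" "E a b d" "E a c d" "E b c d"
    by (auto simp: cnt_def edge_count_def of_bool_def split: if_splits)
  then show ?thesis
    using assms check_4 by (intro total_nonneg_if_check[of 4]) simp_all
qed

text \<open>Downward induction on the lower bound for the edges in a four-set, from 4 to 1. The
  bound 1 always holds because there is no induced \<open>I34\<close>.\<close>

lemma total_nonneg: "0 \<le> total a b c d e f"
proof -
  have 3: "all_ge 3 a b c d e f \<Longrightarrow> 0 \<le> total a b c d e f" for a b c d e f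
    using total_nonneg_step[of 3] total_nonneg_3 total_nonneg_4 by simp
  have 2: "all_ge 2 a b c d e f \<Longrightarrow> 0 \<le> total a b c d e f" for a b c d e f
    using total_nonneg_step[of 2] total_nonneg_2 3 by simp
  have 1: "all_ge 1 a b c d e f \<Longrightarrow> 0 \<le> total a b c d e f" for a b c d e f
    using total_nonneg_step[of 1] total_nonneg_1 2 by simp
  show ?thesis
    by (rule 1) (simp add: all_ge_def cnt_ge_1)
qed

end

section \<open>Averaging over six-tuples\<close>

lemma sum_sum_mult:
  fixes h :: "'a \<Rightarrow> int"
  shows "(\<Sum>e\<in>V. \<Sum>f\<in>V. w * (h e * h f)) = w * (\<Sum>e\<in>V. h e)\<^sup>2"
  unfolding power2_eq_square sum_product by (simp only: sum_distrib_left)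

text \<open>Coordinate by coordinate, the double sum is a nonnegative weight times the square of a
  sum.\<close>

lemma sum_dot_nonneg:
  assumes "finite V" "\<And>e. e \<in> V \<Longrightarrow> length (x e) = length ws" "\<forall>w\<in>set ws. 0 \<le> w"
  shows "0 \<le> (\<Sum>e\<in>V. \<Sum>f\<in>V. dot ws (x e) (x f))"
  using assms(2,3)
proof (induction ws arbitrary: x)
  case Nil
  then show ?case by simp
next
  case (Cons w ws)
  have dot: "dot (w # ws) (x e) (x f) = w * (hd (x e) * hd (x f)) + dot ws (tl (x e)) (tl (x f))"
    if "e \<in> V" "f \<in> V" for e f
    using Cons.prems(1)[OF that(1)] Cons.prems(1)[OF that(2)]
    by (cases "x e"; cases "x f") auto
  have "(\<Sum>e\<in>V. \<Sum>f\<in>V. dot (w # ws) (x e) (x f)) =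
      w * (\<Sum>e\<in>V. hd (x e))\<^sup>2 + (\<Sum>e\<in>V. \<Sum>f\<in>V. dot ws (tl (x e)) (tl (x f)))"
    by (simp add: dot sum.distrib sum_sum_mult cong: sum.cong)
  moreover have "0 \<le> (\<Sum>e\<in>V. \<Sum>f\<in>V. dot ws (tl (x e)) (tl (x f)))"
    using Cons.prems by (intro Cons.IH) auto
  ultimately show ?case
    using Cons.prems(2) by simp
qed

lemma sum_Q_nonneg:
  assumes "finite V"
  shows "0 \<le> (\<Sum>e\<in>V. \<Sum>f\<in>V. Q1 (l e) (l f))" "0 \<le> (\<Sum>e\<in>V. \<Sum>f\<in>V. Q2 (l e) (l f))"
  unfolding Q1_def Q2_def form1_def form2_def
  using assms by (intro sum_dot_nonneg; simp add: length_vec1 length_vec2)+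

lemma sum_quad_nonneg:
  assumes "finite V"
  shows "0 \<le> (\<Sum>e\<in>V. \<Sum>f\<in>V. quad p q r s (l e) (l f))"
  using assms by (cases p; cases q; cases r; cases s) (simp_all add: sum_Q_nonneg)

lemma sum6:
  "(\<Sum>(a, b, c, d, e, f)\<in>V \<times> V \<times> V \<times> V \<times> V \<times> V. g a b c d e f) =
    (\<Sum>a\<in>V. \<Sum>b\<in>V. \<Sum>c\<in>V. \<Sum>d\<in>V. \<Sum>e\<in>V. \<Sum>f\<in>V. g a b c d e f)"
  by (simp only: sum.cartesian_product[symmetric])

text \<open>Cauchy-Schwarz, by expanding the squares of all differences
  \<open>D a - D b\<close>.\<close>

lemma sum_square_le:
  fixes D :: "'a \<Rightarrow> int"
  assumes "finite V"
  shows "(\<Sum>a\<in>V. D a)\<^sup>2 \<le> card V * (\<Sum>a\<in>V. (D a)\<^sup>2)"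
proof -
  have "0 \<le> (\<Sum>a\<in>V. \<Sum>b\<in>V. (D a - D b)\<^sup>2)"
    by (intro sum_nonneg) simp
  also have "\<dots> = (\<Sum>a\<in>V. \<Sum>b\<in>V. (D a)\<^sup>2 + (D b)\<^sup>2 - 2 * (D a * D b))"
    by (simp add: power2_diff mult.assoc)
  also have "\<dots> = 2 * (card V * (\<Sum>a\<in>V. (D a)\<^sup>2)) - 2 * (\<Sum>a\<in>V. D a)\<^sup>2"
    by (simp only: sum.distrib sum_subtractf sum_sum_mult) (simp flip: sum_distrib_left)
  finally show ?thesis by simp
qed

context triple_system
begin

theorem density_ge:
  assumes "finite V"
  shows "4 * int (card V) ^ 3 \<le> 9 * (\<Sum>a\<in>V. \<Sum>b\<in>V. \<Sum>c\<in>V. of_bool (E a b c))"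
proof -
  define n where "n = int (card V)"
  define S where "S = (\<Sum>a\<in>V. \<Sum>b\<in>V. \<Sum>c\<in>V. of_bool (E a b c) :: int)"
  define D where "D a = (\<Sum>b\<in>V. \<Sum>c\<in>V. of_bool (E a b c) :: int)" for a
  let ?V6 = "V \<times> V \<times> V \<times> V \<times> V \<times> V"
  let ?M = "\<Sum>(a, b, c, d, e, f)\<in>?V6. of_bool (E a b c) :: int"
  let ?P = "\<Sum>(a, b, c, d, e, f)\<in>?V6. of_bool (E a b c \<and> E a d e) :: int"
  let ?T = "\<Sum>(a, b, c, d, e, f)\<in>?V6. val a b c d e f"
  \<comment> \<open>The coordinates that do not occur in the summand contribute the powers of
    \<open>n\<close>.\<close>
  have M: "?M = n ^ 3 * S"
    unfolding sum6 by (simp add: S_def n_def power3_eq_cube mult.assoc flip: sum_distrib_left)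
  have P: "?P = n * (\<Sum>a\<in>V. (D a)\<^sup>2)"
    unfolding sum6
    by (simp add: n_def power2_eq_square of_bool_conj flip: sum_distrib_left sum_distrib_right D_def)
  have edges:
    "(\<Sum>(a, b, c, d, e, f)\<in>?V6. of_bool (E a b d) :: int) = ?M"
    "(\<Sum>(a, b, c, d, e, f)\<in>?V6. of_bool (E a c d) :: int) = ?M"
    "(\<Sum>(a, b, c, d, e, f)\<in>?V6. of_bool (E b c d) :: int) = ?M"
    subgoal by (rule sum.reindex_bij_witness[of _ "\<lambda>(a, b, d, c, e, f). (a, b, c, d, e, f)"
          "\<lambda>(a, b, c, d, e, f). (a, b, d, c, e, f)"]) auto
    subgoal by (rule sum.reindex_bij_witness[of _ "\<lambda>(a, c, d, b, e, f). (a, b, c, d, e, f)"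
          "\<lambda>(a, b, c, d, e, f). (a, c, d, b, e, f)"]) auto
    subgoal by (rule sum.reindex_bij_witness[of _ "\<lambda>(b, c, d, a, e, f). (a, b, c, d, e, f)"
          "\<lambda>(a, b, c, d, e, f). (b, c, d, a, e, f)"]) auto
    done
  \<comment> \<open>Both edges meet in the vertex \<open>e\<close> or \<open>f\<close>, which the
    reindexing moves to the front.\<close>
  have matchings:
    "(\<Sum>(a, b, c, d, e, f)\<in>?V6. of_bool (E a b e \<and> E c d e) :: int) = ?P"
    "(\<Sum>(a, b, c, d, e, f)\<in>?V6. of_bool (E a c e \<and> E b d e) :: int) = ?P"
    "(\<Sum>(a, b, c, d, e, f)\<in>?V6. of_bool (E a d e \<and> E b c e) :: int) = ?P"
    "(\<Sum>(a, b, c, d, e, f)\<in>?V6. of_bool (E a b f \<and> E c d f) :: int) = ?P"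
    "(\<Sum>(a, b, c, d, e, f)\<in>?V6. of_bool (E a c f \<and> E b d f) :: int) = ?P"
    "(\<Sum>(a, b, c, d, e, f)\<in>?V6. of_bool (E a d f \<and> E b c f) :: int) = ?P"
    subgoal by (rule sum.reindex_bij_witness[of _ "\<lambda>(e, a, b, c, d, f). (a, b, c, d, e, f)"
          "\<lambda>(a, b, c, d, e, f). (e, a, b, c, d, f)"]) (auto simp: sym12 sym23)
    subgoal by (rule sum.reindex_bij_witness[of _ "\<lambda>(e, a, c, b, d, f). (a, b, c, d, e, f)"
          "\<lambda>(a, b, c, d, e, f). (e, a, c, b, d, f)"]) (auto simp: sym12 sym23)
    subgoal by (rule sum.reindex_bij_witness[of _ "\<lambda>(e, a, d, b, c, f). (a, b, c, d, e, f)"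
          "\<lambda>(a, b, c, d, e, f). (e, a, d, b, c, f)"]) (auto simp: sym12 sym23)
    subgoal by (rule sum.reindex_bij_witness[of _ "\<lambda>(f, a, b, c, d, e). (a, b, c, d, e, f)"
          "\<lambda>(a, b, c, d, e, f). (f, a, b, c, d, e)"]) (auto simp: sym12 sym23)
    subgoal by (rule sum.reindex_bij_witness[of _ "\<lambda>(f, a, c, b, d, e). (a, b, c, d, e, f)"
          "\<lambda>(a, b, c, d, e, f). (f, a, c, b, d, e)"]) (auto simp: sym12 sym23)
    subgoal by (rule sum.reindex_bij_witness[of _ "\<lambda>(f, a, d, b, c, e). (a, b, c, d, e, f)"
          "\<lambda>(a, b, c, d, e, f). (f, a, d, b, c, e)"]) (auto simp: sym12 sym23)
    done
  \<comment> \<open>For fixed a, b, c, d the sum over e and f is a positive semidefinite form on the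
    diagonal.\<close>
  have quad: "0 \<le> (\<Sum>(a, b, c, d, e, f)\<in>?V6.
      quad (E a b c) (E a b d) (E a c d) (E b c d) (link E a b c d e) (link E a b c d f))"
    unfolding sum6 using assms by (intro sum_nonneg sum_quad_nonneg)
  \<comment> \<open>Four triples of weight 26 give 104; three complementary pairs in each of two
    links, of weight 12, give 72.\<close>
  have "?T = 16740 * (104 * ?M - 32 * n ^ 6 - 72 * ?P) - (\<Sum>(a, b, c, d, e, f)\<in>?V6.
      quad (E a b c) (E a b d) (E a c d) (E b c d) (link E a b c d e) (link E a b c d f))"
  proof -
    have "val a b c d e f = 16740 * (26 * (of_bool (E a b c) + of_bool (E a b d) + of_bool (E a c d) + of_bool (E b c d))
        - 32 - 12 * (of_bool (E a b e \<and> E c d e) + of_bool (E a c e \<and> E b d e) + of_bool (E a d e \<and> E b c e)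
          + of_bool (E a b f \<and> E c d f) + of_bool (E a c f \<and> E b d f) + of_bool (E a d f \<and> E b c f)))
        - quad (E a b c) (E a b d) (E a c d) (E b c d) (link E a b c d e) (link E a b c d f)" for a b c d e f
      by (simp add: val_def term_val_def edge_weight_def link_def match_weight.simps algebra_simps)
    moreover have "(\<Sum>(a, b, c, d, e, f)\<in>?V6. 1 :: int) = n ^ 6"
      unfolding n_def by (simp add: card_cartesian_product split_beta numeral_eq_Suc mult.assoc)
    ultimately show ?thesis
      using edges matchings
      by (simp add: split_def sum.distrib sum_subtractf flip: sum_distrib_left)
  qed
  moreover have "(\<Sum>(a, b, c, d, e, f)\<in>?V6. total a b c d e f) = 15 * ?T"
  proof -
    have
      "(\<Sum>(a, b, c, d, e, f)\<in>?V6. val c d e f a b) = ?T"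
      "(\<Sum>(a, b, c, d, e, f)\<in>?V6. val b d e f a c) = ?T"
      "(\<Sum>(a, b, c, d, e, f)\<in>?V6. val b c e f a d) = ?T"
      "(\<Sum>(a, b, c, d, e, f)\<in>?V6. val b c d f a e) = ?T"
      "(\<Sum>(a, b, c, d, e, f)\<in>?V6. val b c d e a f) = ?T"
      "(\<Sum>(a, b, c, d, e, f)\<in>?V6. val a d e f b c) = ?T"
      "(\<Sum>(a, b, c, d, e, f)\<in>?V6. val a c e f b d) = ?T"
      "(\<Sum>(a, b, c, d, e, f)\<in>?V6. val a c d f b e) = ?T"
      "(\<Sum>(a, b, c, d, e, f)\<in>?V6. val a c d e b f) = ?T"
      "(\<Sum>(a, b, c, d, e, f)\<in>?V6. val a b e f c d) = ?T"
      "(\<Sum>(a, b, c, d, e, f)\<in>?V6. val a b d f c e) = ?T"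
      "(\<Sum>(a, b, c, d, e, f)\<in>?V6. val a b d e c f) = ?T"
      "(\<Sum>(a, b, c, d, e, f)\<in>?V6. val a b c f d e) = ?T"
      "(\<Sum>(a, b, c, d, e, f)\<in>?V6. val a b c e d f) = ?T"
      subgoal by (rule sum.reindex_bij_witness[of _ "\<lambda>(c, d, e, f, a, b). (a, b, c, d, e, f)"
          "\<lambda>(a, b, c, d, e, f). (c, d, e, f, a, b)"]) auto
      subgoal by (rule sum.reindex_bij_witness[of _ "\<lambda>(b, d, e, f, a, c). (a, b, c, d, e, f)"
          "\<lambda>(a, b, c, d, e, f). (b, d, e, f, a, c)"]) auto
      subgoal by (rule sum.reindex_bij_witness[of _ "\<lambda>(b, c, e, f, a, d). (a, b, c, d, e, f)"
          "\<lambda>(a, b, c, d, e, f). (b, c, e, f, a, d)"]) auto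
      subgoal by (rule sum.reindex_bij_witness[of _ "\<lambda>(b, c, d, f, a, e). (a, b, c, d, e, f)"
          "\<lambda>(a, b, c, d, e, f). (b, c, d, f, a, e)"]) auto
      subgoal by (rule sum.reindex_bij_witness[of _ "\<lambda>(b, c, d, e, a, f). (a, b, c, d, e, f)"
          "\<lambda>(a, b, c, d, e, f). (b, c, d, e, a, f)"]) auto
      subgoal by (rule sum.reindex_bij_witness[of _ "\<lambda>(a, d, e, f, b, c). (a, b, c, d, e, f)"
          "\<lambda>(a, b, c, d, e, f). (a, d, e, f, b, c)"]) auto
      subgoal by (rule sum.reindex_bij_witness[of _ "\<lambda>(a, c, e, f, b, d). (a, b, c, d, e, f)"
          "\<lambda>(a, b, c, d, e, f). (a, c, e, f, b, d)"]) auto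
      subgoal by (rule sum.reindex_bij_witness[of _ "\<lambda>(a, c, d, f, b, e). (a, b, c, d, e, f)"
          "\<lambda>(a, b, c, d, e, f). (a, c, d, f, b, e)"]) auto
      subgoal by (rule sum.reindex_bij_witness[of _ "\<lambda>(a, c, d, e, b, f). (a, b, c, d, e, f)"
          "\<lambda>(a, b, c, d, e, f). (a, c, d, e, b, f)"]) auto
      subgoal by (rule sum.reindex_bij_witness[of _ "\<lambda>(a, b, e, f, c, d). (a, b, c, d, e, f)"
          "\<lambda>(a, b, c, d, e, f). (a, b, e, f, c, d)"]) auto
      subgoal by (rule sum.reindex_bij_witness[of _ "\<lambda>(a, b, d, f, c, e). (a, b, c, d, e, f)"
          "\<lambda>(a, b, c, d, e, f). (a, b, d, f, c, e)"]) auto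
      subgoal by (rule sum.reindex_bij_witness[of _ "\<lambda>(a, b, d, e, c, f). (a, b, c, d, e, f)"
          "\<lambda>(a, b, c, d, e, f). (a, b, d, e, c, f)"]) auto
      subgoal by (rule sum.reindex_bij_witness[of _ "\<lambda>(a, b, c, f, d, e). (a, b, c, d, e, f)"
          "\<lambda>(a, b, c, d, e, f). (a, b, c, f, d, e)"]) auto
      subgoal by (rule sum.reindex_bij_witness[of _ "\<lambda>(a, b, c, e, d, f). (a, b, c, d, e, f)"
          "\<lambda>(a, b, c, d, e, f). (a, b, c, e, d, f)"]) auto
      done
    then show ?thesis
      unfolding total_def by (simp add: split_def sum.distrib)
  qed
  moreover have "0 \<le> (\<Sum>(a, b, c, d, e, f)\<in>?V6. total a b c d e f)"
    by (intro sum_nonneg) (auto simp: total_nonneg)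
  moreover have "0 \<le> X" if "T = 16740 * X - q" "t = 15 * T" "0 \<le> t" "0 \<le> q" for T X q t :: int
    using that by linarith
  ultimately have "0 \<le> 104 * ?M - 32 * n ^ 6 - 72 * ?P"
    using quad by blast
  moreover have "S\<^sup>2 \<le> ?P"
    using sum_square_le[OF assms, of D] unfolding P by (simp add: S_def D_def n_def)
  \<comment> \<open>With \<open>s = S / n ^ 3\<close> this is \<open>104 s - 32 - 72 s\<^sup>2 = 8 (9 s - 4) (1 - s)\<close>.\<close>
  ultimately have nonneg: "0 \<le> 8 * ((9 * S - 4 * n ^ 3) * (n ^ 3 - S))"
    unfolding M by (simp add: algebra_simps power2_eq_square flip: power_add)
  \<comment> \<open>Otherwise the first factor is negative, while \<open>S\<close> lies below 4/9 of
    \<open>n ^ 3\<close> and so the second factor is positive.\<close>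
  have "4 * n ^ 3 \<le> 9 * S"
  proof (rule ccontr)
    assume *: "\<not> 4 * n ^ 3 \<le> 9 * S"
    moreover have "0 \<le> n ^ 3"
      by (simp add: n_def)
    ultimately have "(9 * S - 4 * n ^ 3) * (n ^ 3 - S) < 0"
      by (intro mult_neg_pos) linarith+
    then show False
      using nonneg by simp
  qed
  then show ?thesis
    by (simp add: n_def S_def)
qed

end

section \<open>Lower bound\<close>

text \<open>Triples that leave the vertex set count as edges as well, so that the relation needs no
  membership guards.\<close>

definition triple_rel :: "'a hypergraph \<Rightarrow> 'a \<Rightarrow> 'a \<Rightarrow> 'a \<Rightarrow> bool" where
  "triple_rel G a b c \<longleftrightarrow>
    a = b \<or> a = c \<or> b = c \<or> \<not> {a, b, c} \<subseteq> verts G \<or> {a, b, c} \<in> edges G"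

lemma not_triple_relD:
  assumes "\<not> triple_rel G a b c"
  shows "a \<noteq> b" "a \<noteq> c" "b \<noteq> c" "a \<in> verts G" "b \<in> verts G" "c \<in> verts G" "{a, b, c} \<notin> edges G"
  using assms by (auto simp: triple_rel_def)

text \<open>The four non-edges cover all pairs of vertices, which forces the vertices to be
  distinct.\<close>

lemma contains_induced_I34:
  assumes G: "three_graph G"
    and n: "\<not> triple_rel G a b c" "\<not> triple_rel G a b d" "\<not> triple_rel G a c d" "\<not> triple_rel G b c d"
  shows "contains_induced G I34"
proof -
  note D = n[THEN not_triple_relD(1)] n[THEN not_triple_relD(2)] n[THEN not_triple_relD(3)]
    n[THEN not_triple_relD(4)] n[THEN not_triple_relD(5)] n[THEN not_triple_relD(6)]
    n[THEN not_triple_relD(7)]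
  let ?W = "{a, b, c, d}"
  let ?f = "\<lambda>i. [a, b, c, d] ! (i - 1)"
  have "bij_betw ?f {1, 2, 3, 4} ?W"
    using D by (auto simp: bij_betw_def inj_on_def)
  moreover have "e \<notin> edges G" if "e \<subseteq> ?W" for e
  proof
    assume e: "e \<in> edges G"
    then obtain x y z where "e = {x, y, z}" "x \<noteq> y" "y \<noteq> z" "x \<noteq> z"
      using G by (auto simp: three_graph_def card_3_iff)
    then show False
      using that e D by (auto simp: insert_commute)
  qed
  ultimately have "isomorphic I34 (induced G ?W)"
    unfolding isomorphic_def by (intro exI[of _ ?f]) (auto simp: I34_def induced_def)
  then show ?thesis
    unfolding contains_induced_def using D by (intro exI[of _ ?W]) auto
qed

text \<open>The six non-edges of \<open>H4\<close> cover all ten pairs of its vertices, so the five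
  vertices are distinct and the degenerate triples create no new copies.\<close>

lemma contains_induced_H4:
  assumes G: "three_graph G"
    and y: "triple_rel G a b c" "triple_rel G a b d" "triple_rel G b c d" "triple_rel G a c x"
    and n: "\<not> triple_rel G a c d" "\<not> triple_rel G a b x" "\<not> triple_rel G a d x"
      "\<not> triple_rel G b c x" "\<not> triple_rel G b d x" "\<not> triple_rel G c d x"
  shows "contains_induced G H4"
proof -
  note D = n[THEN not_triple_relD(1)] n[THEN not_triple_relD(2)] n[THEN not_triple_relD(3)]
    n[THEN not_triple_relD(4)] n[THEN not_triple_relD(5)] n[THEN not_triple_relD(6)]
    n[THEN not_triple_relD(7)]
  let ?W = "{a, b, c, d, x}"
  let ?f = "\<lambda>i. [a, b, c, d, x] ! (i - 1)"
  have edges: "{a, b, c} \<in> edges G" "{a, b, d} \<in> edges G" "{b, c, d} \<in> edges G" "{a, c, x} \<in> edges G"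
    using y D by (auto simp: triple_rel_def)
  have "bij_betw ?f {1, 2, 3, 4, 5} ?W"
    using D by (auto simp: bij_betw_def inj_on_def)
  moreover have "{e \<in> edges G. e \<subseteq> ?W} = {{a, b, c}, {a, b, d}, {b, c, d}, {a, c, x}}"
  proof (intro equalityI subsetI)
    fix e assume "e \<in> {e \<in> edges G. e \<subseteq> ?W}"
    then have e: "e \<in> edges G" "e \<subseteq> ?W" by auto
    then obtain u v w where uvw: "e = {u, v, w}" "u \<noteq> v" "v \<noteq> w" "u \<noteq> w"
      using G by (auto simp: three_graph_def card_3_iff)
    have "u \<in> ?W" "v \<in> ?W" "w \<in> ?W"
      using e uvw by auto
    then show "e \<in> {{a, b, c}, {a, b, d}, {b, c, d}, {a, c, x}}"
      using e(1) uvw D by (elim insertE emptyE) (simp_all add: insert_commute)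
  qed (use edges in auto)
  ultimately have "isomorphic H4 (induced G ?W)"
    unfolding isomorphic_def by (intro exI[of _ ?f]) (simp add: H4_def induced_def)
  then show ?thesis
    unfolding contains_induced_def using D by (intro exI[of _ ?W]) auto
qed

lemma triple_system_triple_rel:
  assumes G: "three_graph G" and free: "induced_free {I34, H4} G"
  shows "triple_system (triple_rel G)"
proof
  show "triple_rel G a b c \<longleftrightarrow> triple_rel G b a c" "triple_rel G a b c \<longleftrightarrow> triple_rel G a c b" for a b c
    by (auto simp: triple_rel_def insert_commute)
  show "triple_rel G a b c \<or> triple_rel G a b d \<or> triple_rel G a c d \<or> triple_rel G b c d" for a b c d
    using contains_induced_I34[OF G] free unfolding induced_free_def by blast
  show "triple_rel G c d x"
    if "triple_rel G a b c" "triple_rel G a b d" "triple_rel G b c d" "triple_rel G a c x"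
      "\<not> triple_rel G a c d" "\<not> triple_rel G a b x" "\<not> triple_rel G a d x"
      "\<not> triple_rel G b c x" "\<not> triple_rel G b d x" for a b c d x
    using contains_induced_H4[OF G that(1-4)] that(5-) free unfolding induced_free_def by blast
qed

section \<open>From ordered triples to edges\<close>

lemma card_ordered_triples_le:
  assumes G: "three_graph G"
  shows "card {(a, b, c). a \<noteq> b \<and> a \<noteq> c \<and> b \<noteq> c \<and> {a, b, c} \<in> edges G} \<le> 6 * card (edges G)"
proof -
  let ?S = "\<lambda>e. {(a, b, c). a \<noteq> b \<and> a \<noteq> c \<and> b \<noteq> c \<and> {a, b, c} = e}"
  have "edges G \<subseteq> Pow (verts G)" "finite (verts G)"
    using G by (auto simp: three_graph_def)
  then have fin: "finite (edges G)"
    by (meson finite_Pow_iff finite_subset)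
  have le: "finite (?S e) \<and> card (?S e) \<le> 6" if "e \<in> edges G" for e
  proof -
    have "card e = 3"
      using G that by (auto simp: three_graph_def)
    then obtain x y z where e: "e = {x, y, z}"
      by (auto simp: card_3_iff)
    let ?L = "[(x, y, z), (x, z, y), (y, x, z), (y, z, x), (z, x, y), (z, y, x)]"
    have "?S e \<subseteq> set ?L"
    proof
      fix t assume "t \<in> ?S e"
      then obtain a b c where t: "t = (a, b, c)" "a \<noteq> b" "a \<noteq> c" "b \<noteq> c" and abc: "{a, b, c} = {x, y, z}"
        unfolding e by blast
      from abc have "a \<in> {x, y, z}" "b \<in> {x, y, z}" "c \<in> {x, y, z}"
        by blast+
      then show "t \<in> set ?L"
        using t by (elim insertE emptyE) simp_all
    qed
    moreover have "card (set ?L) \<le> 6"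
      using card_length[of ?L] by simp
    ultimately show ?thesis
      by (meson List.finite_set card_mono finite_subset le_trans)
  qed
  have "card (\<Union>e\<in>edges G. ?S e) \<le> (\<Sum>e\<in>edges G. card (?S e))"
    by (rule card_UN_le[OF fin])
  also have "\<dots> \<le> (\<Sum>e\<in>edges G. 6)"
    using le by (intro sum_mono) auto
  also have "(\<Union>e\<in>edges G. ?S e) = {(a, b, c). a \<noteq> b \<and> a \<noteq> c \<and> b \<noteq> c \<and> {a, b, c} \<in> edges G}"
    by auto
  finally show ?thesis by simp
qed

text \<open>At most \<open>3 * n ^ 2\<close> ordered triples have a repeated vertex, and each edge
  accounts for at most six others; \<open>density_ge\<close> bounds their total from below.\<close>

lemma edges_lower_bound:
  assumes G: "three_graph G" and free: "induced_free {I34, H4} G"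
  shows "4 * int (card (verts G)) ^ 3 \<le> 54 * int (card (edges G)) + 27 * int (card (verts G)) ^ 2"
proof -
  interpret triple_system "triple_rel G"
    using assms by (rule triple_system_triple_rel)
  let ?V = "verts G"
  let ?S = "{(a, b, c). a \<noteq> b \<and> a \<noteq> c \<and> b \<noteq> c \<and> {a, b, c} \<in> edges G}"
  have fin: "finite ?V" and sub: "\<And>e. e \<in> edges G \<Longrightarrow> e \<subseteq> ?V"
    using G by (auto simp: three_graph_def)
  have S: "?S \<subseteq> ?V \<times> ?V \<times> ?V"
    using sub by auto
  have "(\<Sum>a\<in>?V. \<Sum>b\<in>?V. \<Sum>c\<in>?V. of_bool (triple_rel G a b c) :: int) \<le>
      (\<Sum>a\<in>?V. \<Sum>b\<in>?V. \<Sum>c\<in>?V. of_bool (a = b) + of_bool (a = c) + of_bool (b = c) + of_bool ((a, b, c) \<in> ?S))"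
    by (intro sum_mono) (auto simp: triple_rel_def)
  also have "\<dots> = 3 * int (card ?V) ^ 2 + (\<Sum>a\<in>?V. \<Sum>b\<in>?V. \<Sum>c\<in>?V. of_bool ((a, b, c) \<in> ?S))"
    using fin by (simp only: sum.distrib) (simp add: of_bool_def sum.delta sum.delta' power2_eq_square flip: sum_distrib_left)
  also have "(\<Sum>a\<in>?V. \<Sum>b\<in>?V. \<Sum>c\<in>?V. of_bool ((a, b, c) \<in> ?S)) = (\<Sum>t\<in>?V \<times> ?V \<times> ?V. of_bool (t \<in> ?S) :: int)"
    by (simp add: sum.cartesian_product split_def)
  also have "\<dots> = int (card ?S)"
    using fin S by (simp add: of_bool_def sum.If_cases Int_absorb1)
  also have "\<dots> \<le> 6 * int (card (edges G))"
    using card_ordered_triples_le[OF G] by linarith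
  finally show ?thesis
    using density_ge[OF fin] by linarith
qed

section \<open>Upper bound\<close>

text \<open>Turan's construction on the residue classes modulo 3. The first argument is the vertex
  that may lie one class before the other two, so an unordered triple has to be tested with each
  vertex in that place.\<close>

definition residue_triple :: "nat \<Rightarrow> nat \<Rightarrow> nat \<Rightarrow> bool" where
  "residue_triple x y z \<longleftrightarrow> y = z \<and> (y = x \<or> y = Suc x mod 3)"

definition turan_triple :: "nat \<Rightarrow> nat \<Rightarrow> nat \<Rightarrow> bool" where
  "turan_triple x y z \<longleftrightarrow> residue_triple (x mod 3) (y mod 3) (z mod 3)"

lemma turan_triple_commute: "turan_triple x z y = turan_triple x y z"
  by (auto simp: turan_triple_def residue_triple_def)

definition turan :: "nat \<Rightarrow> nat hypergraph" where
  "turan n = \<lparr>verts = {..<n}, edges = {{x, y, z} | x y z.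
     x < n \<and> y < n \<and> z < n \<and> x \<noteq> y \<and> x \<noteq> z \<and> y \<noteq> z \<and> turan_triple x y z}\<rparr>"

lemma verts_turan: "verts (turan n) = {..<n}"
  by (simp add: turan_def)

lemma three_graph_turan: "three_graph (turan n)"
  by (auto simp: three_graph_def turan_def)

lemma turan_edge_iff:
  assumes "x \<noteq> y" "x \<noteq> z" "y \<noteq> z" "x < n" "y < n" "z < n"
  shows "{x, y, z} \<in> edges (turan n) \<longleftrightarrow> turan_triple x y z \<or> turan_triple y x z \<or> turan_triple z x y"
proof
  assume "{x, y, z} \<in> edges (turan n)"
  then obtain x' y' z' where *: "{x, y, z} = {x', y', z'}" "x' \<noteq> y'" "x' \<noteq> z'" "y' \<noteq> z'" "turan_triple x' y' z'"
    by (auto simp: turan_def)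
  have "x' \<in> {x, y, z}" "y' \<in> {x, y, z}" "z' \<in> {x, y, z}"
    unfolding *(1) by simp_all
  then show "turan_triple x y z \<or> turan_triple y x z \<or> turan_triple z x y"
    using *(2-) turan_triple_commute by (elim insertE emptyE) blast+
next
  have edge: "{x', y', z'} \<in> edges (turan n)"
    if "x' < n" "y' < n" "z' < n" "x' \<noteq> y'" "x' \<noteq> z'" "y' \<noteq> z'" "turan_triple x' y' z'" for x' y' z'
    using that unfolding turan_def by fastforce
  have "{y, x, z} = {x, y, z}" "{z, x, y} = {x, y, z}"
    by auto
  then show "{x, y, z} \<in> edges (turan n)"
    if "turan_triple x y z \<or> turan_triple y x z \<or> turan_triple z x y"
    using that assms edge[of x y z] edge[of y x z] edge[of z x y] by auto
qed

text \<open>A check of 81 cases. The first claim excludes \<open>I34\<close>; the second forbids the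
  three edges that the vertices 1, 2, 3, 4 of \<open>H4\<close> span without 134.\<close>

lemma residue_quad:
  fixes a b c d :: nat
  defines "T \<equiv> \<lambda>x y z. residue_triple x y z \<or> residue_triple y x z \<or> residue_triple z x y"
  assumes "a < 3" "b < 3" "c < 3" "d < 3"
  shows "T a b c \<or> T a b d \<or> T a c d \<or> T b c d" and "T a b c \<Longrightarrow> T a b d \<Longrightarrow> T b c d \<Longrightarrow> T a c d"
proof -
  have "x \<in> {0, 1, 2}" if "x < 3" for x :: nat
    using that by auto
  then have "a \<in> {0, 1, 2}" "b \<in> {0, 1, 2}" "c \<in> {0, 1, 2}" "d \<in> {0, 1, 2}"
    using assms by blast+
  then show "T a b c \<or> T a b d \<or> T a c d \<or> T b c d" "T a b c \<Longrightarrow> T a b d \<Longrightarrow> T b c d \<Longrightarrow> T a c d"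
    by (elim insertE emptyE; simp add: T_def residue_triple_def)+
qed

lemma induced_free_turan: "induced_free {I34, H4} (turan n)"
proof -
  let ?T = "\<lambda>x y z. turan_triple x y z \<or> turan_triple y x z \<or> turan_triple z x y"
  have T: "{x, y, z} \<in> edges (turan n) \<longleftrightarrow> ?T x y z"
    if "W \<subseteq> {..<n}" "x \<in> W" "y \<in> W" "z \<in> W" "x \<noteq> y" "x \<noteq> z" "y \<noteq> z" for x y z W
    using that by (intro turan_edge_iff) auto
  note quad = residue_quad[of "x mod 3" "y mod 3" "z mod 3" "w mod 3" for x y z w, simplified]
  have "\<not> contains_induced (turan n) I34"
  proof
    assume "contains_induced (turan n) I34"
    then obtain W and f :: "nat \<Rightarrow> nat" where W: "W \<subseteq> {..<n}" and f: "bij_betw f {1, 2, 3, 4} W"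
      and E: "{e \<in> edges (turan n). e \<subseteq> W} = {}"
      by (auto simp: contains_induced_def isomorphic_def induced_def verts_turan I34_def simp del: One_nat_def)
    have in_W: "f 1 \<in> W" "f 2 \<in> W" "f 3 \<in> W" "f 4 \<in> W"
      using f by (auto simp: bij_betw_def)
    have neq: "f 1 \<noteq> f 2" "f 1 \<noteq> f 3" "f 1 \<noteq> f 4" "f 2 \<noteq> f 3" "f 2 \<noteq> f 4" "f 3 \<noteq> f 4"
      using f by (auto simp: bij_betw_def inj_on_def)
    have "\<not> ?T (f 1) (f 2) (f 3)" "\<not> ?T (f 1) (f 2) (f 4)" "\<not> ?T (f 1) (f 3) (f 4)" "\<not> ?T (f 2) (f 3) (f 4)"
      using E T[OF W] in_W neq by blast+
    then show False
      using quad[of "f 1" "f 2" "f 3" "f 4"] unfolding turan_triple_def by blast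
  qed
  moreover have "\<not> contains_induced (turan n) H4"
  proof
    assume "contains_induced (turan n) H4"
    then obtain W and f :: "nat \<Rightarrow> nat" where W: "W \<subseteq> {..<n}" and f: "bij_betw f {1, 2, 3, 4, 5} W"
      and E: "{e \<in> edges (turan n). e \<subseteq> W} = (\<lambda>e. f ` e) ` {{1, 2, 3}, {1, 2, 4}, {2, 3, 4}, {1, 3, 5}}"
      by (auto simp: contains_induced_def isomorphic_def induced_def verts_turan H4_def simp del: One_nat_def)
    have in_W: "f 1 \<in> W" "f 2 \<in> W" "f 3 \<in> W" "f 4 \<in> W" "f 5 \<in> W"
      using f by (auto simp: bij_betw_def)
    have neq: "f 1 \<noteq> f 2" "f 1 \<noteq> f 3" "f 1 \<noteq> f 4" "f 1 \<noteq> f 5" "f 2 \<noteq> f 3" "f 2 \<noteq> f 4" "f 2 \<noteq> f 5" "f 3 \<noteq> f 4"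
      "f 3 \<noteq> f 5" "f 4 \<noteq> f 5"
      using f by (auto simp: bij_betw_def inj_on_def)
    have "{f 1, f 2, f 3} \<in> edges (turan n)" "{f 1, f 2, f 4} \<in> edges (turan n)" "{f 2, f 3, f 4} \<in> edges (turan n)"
      using E by auto
    \<comment> \<open>Every edge of \<open>H4\<close> contains 2 or 5, so 134 is not among
      them.\<close>
    moreover have "X \<notin> {{f 1, f 2, f 3}, {f 1, f 2, f 4}, {f 2, f 3, f 4}, {f 1, f 3, f 5}}"
      if "f 2 \<notin> X" "f 5 \<notin> X" for X
      using that by auto
    from this[of "{f 1, f 3, f 4}"]
    have "{f 1, f 3, f 4} \<notin> {{f 1, f 2, f 3}, {f 1, f 2, f 4}, {f 2, f 3, f 4}, {f 1, f 3, f 5}}"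
      using neq by simp
    then have "{f 1, f 3, f 4} \<notin> {e \<in> edges (turan n). e \<subseteq> W}"
      unfolding E by simp
    then have "{f 1, f 3, f 4} \<notin> edges (turan n)"
      using in_W by simp
    ultimately have "?T (f 1) (f 2) (f 3)" "?T (f 1) (f 2) (f 4)" "?T (f 2) (f 3) (f 4)" "\<not> ?T (f 1) (f 3) (f 4)"
      using T[OF W in_W(1-3)] T[OF W in_W(1,2,4)] T[OF W in_W(2-4)] T[OF W in_W(1,3,4)] neq by simp_all
    then show False
      using quad[of "f 1" "f 2" "f 3" "f 4"] unfolding turan_triple_def by blast
  qed
  ultimately show ?thesis
    by (simp add: induced_free_def)
qed

section \<open>Counting the edges of Turan's construction\<close>

lemma card_residue_class_le: "3 * card {v. v < n \<and> v mod 3 = i} \<le> n + 2"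
proof -
  have "{v. v < n \<and> v mod 3 = i} \<subseteq> (\<lambda>q. 3 * q + i) ` {..<(n + 2) div 3}"
  proof
    fix v assume "v \<in> {v. v < n \<and> v mod 3 = i}"
    then have "v = 3 * (v div 3) + i" "v div 3 < (n + 2) div 3"
      by auto
    then show "v \<in> (\<lambda>q. 3 * q + i) ` {..<(n + 2) div 3}"
      by blast
  qed
  then have "card {v. v < n \<and> v mod 3 = i} \<le> card {..<(n + 2) div 3}"
    by (meson card_image_le card_mono finite_imageI finite_lessThan le_trans)
  then show ?thesis by simp
qed

lemma card_edges_turan_le: "27 * card (edges (turan n)) \<le> 2 * (n + 2) ^ 3"
proof -
  define A where "A i = {v. v < n \<and> v mod 3 = i}" for i
  \<comment> \<open>This is n/3 rounded up, the size of a largest class.\<close>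
  define m where "m = (n + 2) div 3"
  have fin: "finite (A i)" and card_A: "card (A i) \<le> m" for i
    using card_residue_class_le[of n i] by (auto simp: A_def m_def)
  let ?mono = "\<lambda>i. {e. e \<subseteq> A i \<and> card e = 3}"
  let ?mixed = "\<lambda>i. (\<lambda>(x, P). insert x P) ` (A i \<times> {P. P \<subseteq> A (Suc i mod 3) \<and> card P = 2})"
  have "edges (turan n) \<subseteq> (\<Union>i<3. ?mono i \<union> ?mixed i)"
  proof
    fix e assume "e \<in> edges (turan n)"
    then obtain x y z where e: "e = {x, y, z}" "x < n" "y < n" "z < n" "x \<noteq> y" "x \<noteq> z" "y \<noteq> z"
      and t: "turan_triple x y z"
      by (auto simp: turan_def)
    have "e \<in> ?mono (x mod 3) \<union> ?mixed (x mod 3)"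
    proof (cases "y mod 3 = x mod 3")
      case True
      then show ?thesis
        using e t by (auto simp: A_def turan_triple_def residue_triple_def)
    next
      case False
      then have "(x, {y, z}) \<in> A (x mod 3) \<times> {P. P \<subseteq> A (Suc (x mod 3) mod 3) \<and> card P = 2}"
        using e t by (auto simp: A_def turan_triple_def residue_triple_def)
      then have "insert x {y, z} \<in> ?mixed (x mod 3)"
        by (rule image_eqI[rotated]) simp
      then show ?thesis
        unfolding e(1) by blast
    qed
    then show "e \<in> (\<Union>i<3. ?mono i \<union> ?mixed i)"
      by (intro UN_I[of "x mod 3"]) auto
  qed
  moreover have fin': "finite (?mono i)" "finite (?mixed i)" for i
    using fin by (auto intro: finite_subset[OF _ finite_Pow_iff[THEN iffD2, OF fin]])
  ultimately have "card (edges (turan n)) \<le> card (\<Union>i<3. ?mono i \<union> ?mixed i)"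
    by (intro card_mono) auto
  also have "\<dots> \<le> (\<Sum>i<3. card (?mono i \<union> ?mixed i))"
    by (intro card_UN_le) simp
  also have "\<dots> \<le> (\<Sum>i<(3::nat). (m choose 3) + m * (m choose 2))"
  proof (intro sum_mono)
    fix i
    have "card (?mono i \<union> ?mixed i) \<le> card (?mono i) + card (?mixed i)"
      by (rule card_Un_le)
    also have "card (?mixed i) \<le> card (A i \<times> {P. P \<subseteq> A (Suc i mod 3) \<and> card P = 2})"
      using fin by (intro card_image_le finite_cartesian_product) (auto intro: finite_subset[OF _ finite_Pow_iff[THEN iffD2, OF fin]])
    also have "\<dots> = card (A i) * (card (A (Suc i mod 3)) choose 2)"
      using fin by (simp add: card_cartesian_product n_subsets)
    also have "\<dots> \<le> m * (m choose 2)"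
      using card_A by (intro mult_le_mono binomial_right_mono)
    also have "card (?mono i) = card (A i) choose 3"
      using fin by (simp add: n_subsets)
    also have "\<dots> \<le> m choose 3"
      using card_A by (rule binomial_right_mono)
    finally show "card (?mono i \<union> ?mixed i) \<le> (m choose 3) + m * (m choose 2)"
      by simp
  qed
  also have "\<dots> = 3 * (m choose 3) + 3 * (m * (m choose 2))"
    by simp
  finally have "2 * card (edges (turan n)) \<le> 6 * (m choose 3) + m * 3 * (2 * (m choose 2))"
    by simp
  \<comment> \<open>By \<open>binomial_fact_pow\<close>, k! times \<open>m choose k\<close> is at
    most \<open>m ^ k\<close>.\<close>
  also have "\<dots> \<le> m ^ 3 + m * 3 * m ^ 2"
    using binomial_fact_pow[of m 3] binomial_fact_pow[of m 2]
    by (intro add_mono mult_le_mono2) (simp_all add: fact_numeral mult.commute)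
  finally have "27 * card (edges (turan n)) \<le> 2 * (3 * m) ^ 3"
    by (simp add: power3_eq_cube power2_eq_square)
  also have "\<dots> \<le> 2 * (n + 2) ^ 3"
    unfolding m_def by (intro mult_le_mono2 power_mono) auto
  finally show ?thesis .
qed

section \<open>The limit\<close>

lemma ex_min_bounds:
  "4 * int n ^ 3 \<le> 54 * int (ex_min n {I34, H4}) + 27 * int n ^ 2"
  "27 * ex_min n {I34, H4} \<le> 2 * (n + 2) ^ 3"
proof -
  let ?S = "{card (edges G) | G :: nat hypergraph. three_graph G \<and> card (verts G) = n \<and> induced_free {I34, H4} G}"
  have turan: "card (edges (turan n)) \<in> ?S"
    using three_graph_turan[of n] induced_free_turan[of n]
    by (intro CollectI exI[of _ "turan n"]) (simp add: turan_def)
  \<comment> \<open>Turan's construction makes the set nonempty, so the infimum is the edge number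
    of an actual 3-graph and the lower bound applies to it.\<close>
  then have "Inf ?S \<in> ?S"
    by (intro Inf_nat_def1) blast
  then show "4 * int n ^ 3 \<le> 54 * int (ex_min n {I34, H4}) + 27 * int n ^ 2"
    unfolding ex_min_def using edges_lower_bound by auto
  have "ex_min n {I34, H4} \<le> card (edges (turan n))"
    unfolding ex_min_def using turan by (intro cInf_lower) auto
  then show "27 * ex_min n {I34, H4} \<le> 2 * (n + 2) ^ 3"
    using card_edges_turan_le[of n] by linarith
qed

lemma choose_three: "real (n choose 3) = real n * (real n - 1) * (real n - 2) / 6"
proof (induction n)
  case (Suc n)
  have "Suc n choose 3 = (n choose 2) + (n choose 3)"
    by (simp add: numeral_3_eq_3 numeral_2_eq_2)
  moreover have "real (n choose 2) = real n * (real n - 1) / 2"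
    by (induction n) (auto simp: numeral_2_eq_2 field_simps)
  ultimately show ?case
    using Suc by (simp add: field_simps)
qed simp

theorem theorem4p1:
  shows "convergent (density_min {I34, H4}) \<and> pi_min {I34, H4} = 4 / 9"
proof -
  let ?lower = "\<lambda>n. (4 * real n ^ 3 - 27 * real n ^ 2) / 54 / (real n * (real n - 1) * (real n - 2) / 6)"
  let ?upper = "\<lambda>n. 2 * (real n + 2) ^ 3 / 27 / (real n * (real n - 1) * (real n - 2) / 6)"
  \<comment> \<open>This includes n < 3, where all three quotients are 0 by division by
    zero.\<close>
  have bounds: "?lower n \<le> density_min {I34, H4} n" "density_min {I34, H4} n \<le> ?upper n" for n
  proof -
    have "real_of_int (4 * int n ^ 3) \<le> real_of_int (54 * int (ex_min n {I34, H4}) + 27 * int n ^ 2)"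
      using ex_min_bounds(1) by (rule of_int_le_iff[THEN iffD2])
    then have "(4 * real n ^ 3 - 27 * real n ^ 2) / 54 \<le> real (ex_min n {I34, H4})"
      by simp
    moreover have "real (27 * ex_min n {I34, H4}) \<le> real (2 * (n + 2) ^ 3)"
      using ex_min_bounds(2) by (rule of_nat_mono)
    then have "real (ex_min n {I34, H4}) \<le> 2 * (real n + 2) ^ 3 / 27"
      by (simp add: add.commute mult.commute)
    ultimately show "?lower n \<le> density_min {I34, H4} n" "density_min {I34, H4} n \<le> ?upper n"
      unfolding density_min_def choose_three[symmetric] by (intro divide_right_mono; simp)+
  qed
  \<comment> \<open>The leading coefficients give 6 * 4/54 = 4/9 here and 6 * 2/27 = 4/9 for the
    upper bound.\<close>
  have lower: "?lower \<longlonglongrightarrow> 4 / 9"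
    by real_asymp
  have upper: "?upper \<longlonglongrightarrow> 4 / 9"
    by real_asymp
  have "density_min {I34, H4} \<longlonglongrightarrow> 4 / 9"
    by (rule tendsto_sandwich[OF _ _ lower upper]) (intro always_eventually allI bounds)+
  then show ?thesis
    unfolding pi_min_def by (intro conjI convergentI limI)
qed

end
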